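(* The octonionic Bergman kernel of $\mathcal{B}^2(\mathbb{R}_+^8)$ exists. More precisely, for $a\in\mathbb{R}_+^8$ and $x\in\mathbb{R}_+^8$ let $$B(x,a)=-2\frac{\partial}{\partial x_0}E(x+\overline{a}),\qquad\text{where } E(x)=\frac{\overline{x}}{|x|^8}\ (x\in\mathbb{O}\setminus\{0\}).$$ Then $B(\cdot,a)$ is the desired octonionic Bergman kernel, i.e., for every $a\in\mathbb{R}_+^8$ one has $B(\cdot,a)\in\mathcal{B}^2(\mathbb{R}_+^8)$, and for any $f\in\mathcal{B}^2(\mathbb{R}_+^8)$ and any $a\in\mathbb{R}_+^8$ the reproducing formula $$f(a)=(f,B(\cdot,a))_{\mathbb{R}_+^8}$$ holds. Moreover, the kernel is unique: for each $a\in\mathbb{R}_+^8$, $B(\cdot,a)$ is the only element of $\mathcal{B}^2(\mathbb{R}_+^8)$ such that this reproducing formula holds for all $f\in\mathcal{B}^2(\mathbb{R}_+^8)$.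
   Context: Octonions: $\mathbb{O}$ is the 8-dimensional real (non-commutative, non-associative, alternative) algebra with basis $e_0,e_1,\ldots,e_7$, where $e_0=1$ is the unit, $e_i^2=-1$ for $i=1,\ldots,7$, and for every triple $(\alpha,\beta,\gamma)$ in $W=\{(1,2,3),(1,4,5),(1,7,6),(2,4,6),(2,5,7),(3,4,7),(3,6,5)\}$ one has $e_\alpha e_\beta=e_\gamma=-e_\beta e_\alpha$, $e_\beta e_\gamma=e_\alpha=-e_\gamma e_\beta$, $e_\gamma e_\alpha=e_\beta=-e_\alpha e_\gamma$; multiplication is extended bilinearly. We identify $\mathbb{O}$ with $\mathbb{R}^8$. For $x=\sum_{i=0}^7 x_ie_i$: $\mathrm{Re}\,x=x_0$, $\overline{x}=x_0-\sum_{i=1}^7x_ie_i$, $|x|=(\sum_{i=0}^7x_i^2)^{1/2}$. Left octonionic analytic functions: for $\Omega\subset\mathbb{R}^8$ open, $f=\sum_{j=0}^7 f_je_j\in C^1(\Omega,\mathbb{O})$ is left octonionic analytic (left $\mathbb{O}$-analytic) in $\Omega$ if $Df=\sum_{i=0}^7 e_i\frac{\partial f}{\partial x_i}=\sum_{i=0}^{7}\sum_{j=0}^{7}\frac{\partial f_j}{\partial x_i}e_ie_j=0$ in $\Omega$. Bergman space: $\mathbb{R}_+^8=\{x\in\mathbb{O}:\mathrm{Re}\,x>0\}$, and $\mathcal{B}^2(\mathbb{R}_+^8)$ is the class of left octonionic analytic functions $f$ on $\mathbb{R}_+^8$ with $\int_{\mathbb{R}_+^8}|f|^2dV<\infty$,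 where $dV$ is the volume element (Lebesgue measure). For $f,g\in\mathcal{B}^2(\mathbb{R}_+^8)$, $$(f,g)_{\mathbb{R}_+^8}:=\frac{1}{\omega_8}\int_{\mathbb{R}_+^8}\overline{g}f\,dV,$$ an octonion-valued inner product, where $\omega_8=\frac{\pi^4}{3}$ is the surface area of the unit sphere in $\mathbb{R}^8$. The octonionic Bergman kernel of $\mathcal{B}^2(\mathbb{R}_+^8)$ is a function $B(x,a)$, $x,a\in\mathbb{R}_+^8$, such that for every $a$ one has $B(\cdot,a)\in\mathcal{B}^2(\mathbb{R}_+^8)$ and $f(a)=(f,B(\cdot,a))_{\mathbb{R}_+^8}$ for all $f\in\mathcal{B}^2(\mathbb{R}_+^8)$. *)

theory Defs
  imports "HOL-Analysis.Analysis"
begin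

text \<open>
  The octonions are identified with \<open>\<real>\<^sup>8\<close>.  The elements of the index type \<open>8\<close> are
  \<open>0, 1, \<dots>, 7\<close>, so the indices agree with the usual numbering of the basis and
  \<open>x $ 0\<close> is the real part.
\<close>

type_synonym octonion = "real ^ 8"

abbreviation oct_e :: "8 \<Rightarrow> octonion" where
  "oct_e i \<equiv> axis i 1"

definition oct_W :: "(8 \<times> 8 \<times> 8) set" where
  "oct_W = {(1,2,3), (1,4,5), (1,7,6), (2,4,6), (2,5,7), (3,4,7), (3,6,5)}"

definition oct_W_cyclic :: "(8 \<times> 8 \<times> 8) set" where
  "oct_W_cyclic =
     oct_W \<union> (\<lambda>(i, j, k). (j, k, i)) ` oct_W \<union> (\<lambda>(i, j, k). (k, i, j)) ` oct_W"

text \<open>Structure constants: \<open>oct_coeff i j k\<close> is the coefficient of \<open>e\<^sub>k\<close> in \<open>e\<^sub>i e\<^sub>j\<close>.\<close>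

definition oct_coeff :: "8 \<Rightarrow> 8 \<Rightarrow> 8 \<Rightarrow> real" where
  "oct_coeff i j k =
     (if i = 0 then (if k = j then 1 else 0)
      else if j = 0 then (if k = i then 1 else 0)
      else if i = j then (if k = 0 then - 1 else 0)
      else if (i, j, k) \<in> oct_W_cyclic then 1
      else if (j, i, k) \<in> oct_W_cyclic then - 1
      else 0)"

definition oct_mult :: "octonion \<Rightarrow> octonion \<Rightarrow> octonion"  (infixl "\<odot>" 70) where
  "x \<odot> y = (\<chi> k. \<Sum>i\<in>UNIV. \<Sum>j\<in>UNIV. x $ i * y $ j * oct_coeff i j k)"

lemma oct_mult_basis: "oct_e i \<odot> oct_e j = (\<chi> k. oct_coeff i j k)"
proof -
  have "(\<Sum>p\<in>UNIV. \<Sum>q\<in>UNIV. oct_e i $ p * oct_e j $ q * oct_coeff p q k) = oct_coeff i j k" for k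
  proof -
    have "(\<Sum>p\<in>UNIV. \<Sum>q\<in>UNIV. oct_e i $ p * oct_e j $ q * oct_coeff p q k)
        = (\<Sum>p\<in>UNIV. \<Sum>q\<in>UNIV. if q = j then (if p = i then oct_coeff p q k else 0) else 0)"
      by (intro sum.cong) (auto simp: axis_def)
    also have "\<dots> = oct_coeff i j k"
      by (simp add: sum.delta)
    finally show ?thesis .
  qed
  then show ?thesis
    by (simp add: oct_mult_def)
qed

lemma bilinear_oct_mult: "bilinear (\<odot>)"
  unfolding bilinear_def
  by (auto intro!: linearI simp: oct_mult_def vec_eq_iff algebra_simps sum.distrib sum_distrib_left)

lemma oct_mult_unit: "oct_e 0 \<odot> oct_e i = oct_e i" "oct_e i \<odot> oct_e 0 = oct_e i"
  unfolding oct_mult_basis by (auto simp: oct_coeff_def axis_def vec_eq_iff)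

lemma oct_mult_square: "i \<noteq> 0 \<Longrightarrow> oct_e i \<odot> oct_e i = - oct_e 0"
  unfolding oct_mult_basis by (auto simp: oct_coeff_def axis_def vec_eq_iff)

lemma oct_W_cyclic_eq:
  "oct_W_cyclic =
     {(1,2,3), (1,4,5), (1,7,6), (2,4,6), (2,5,7), (3,4,7), (3,6,5),
      (2,3,1), (4,5,1), (7,6,1), (4,6,2), (5,7,2), (4,7,3), (6,5,3),
      (3,1,2), (5,1,4), (6,1,7), (6,2,4), (7,2,5), (7,3,4), (5,3,6)}"
  unfolding oct_W_cyclic_def oct_W_def
  by (simp only: image_insert image_empty prod.case Un_insert_left Un_empty_left)

lemma oct_W_cyclicD:
  assumes "(a, b, c) \<in> oct_W_cyclic"
  shows "a \<noteq> 0" "b \<noteq> 0" "a \<noteq> b"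
    "(a, b, k) \<in> oct_W_cyclic \<longleftrightarrow> k = c" "(b, a, k) \<notin> oct_W_cyclic"
proof -
  have "\<forall>(a, b, c)\<in>oct_W_cyclic. a \<noteq> 0 \<and> b \<noteq> 0 \<and> a \<noteq> b \<and>
          ((a, b, k) \<in> oct_W_cyclic \<longleftrightarrow> k = c) \<and> (b, a, k) \<notin> oct_W_cyclic"
    unfolding oct_W_cyclic_eq by simp
  from bspec[OF this assms] show "a \<noteq> 0" "b \<noteq> 0" "a \<noteq> b"
    "(a, b, k) \<in> oct_W_cyclic \<longleftrightarrow> k = c" "(b, a, k) \<notin> oct_W_cyclic"
    unfolding prod.case by iprover+
qed

lemma oct_mult_W_cyclic:
  assumes "(a, b, c) \<in> oct_W_cyclic"
  shows "oct_e a \<odot> oct_e b = oct_e c" "oct_e b \<odot> oct_e a = - oct_e c"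
  unfolding oct_mult_basis using oct_W_cyclicD[OF assms]
  by (auto simp: oct_coeff_def axis_def vec_eq_iff)

lemma oct_mult_W:
  assumes "(a, b, c) \<in> oct_W"
  shows "oct_e a \<odot> oct_e b = oct_e c" "oct_e b \<odot> oct_e a = - oct_e c"
    "oct_e b \<odot> oct_e c = oct_e a" "oct_e c \<odot> oct_e b = - oct_e a"
    "oct_e c \<odot> oct_e a = oct_e b" "oct_e a \<odot> oct_e c = - oct_e b"
proof -
  have *: "(a, b, c) \<in> oct_W_cyclic" "(b, c, a) \<in> oct_W_cyclic" "(c, a, b) \<in> oct_W_cyclic"
    using assms imageI[OF assms, of "\<lambda>(i, j, k). (j, k, i)"]
      imageI[OF assms, of "\<lambda>(i, j, k). (k, i, j)"]
    unfolding oct_W_cyclic_def Un_iff prod.case by iprover+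
  show "oct_e a \<odot> oct_e b = oct_e c" "oct_e b \<odot> oct_e a = - oct_e c"
    "oct_e b \<odot> oct_e c = oct_e a" "oct_e c \<odot> oct_e b = - oct_e a"
    "oct_e c \<odot> oct_e a = oct_e b" "oct_e a \<odot> oct_e c = - oct_e b"
    by (rule oct_mult_W_cyclic[OF *(1)] oct_mult_W_cyclic[OF *(2)] oct_mult_W_cyclic[OF *(3)])+
qed

definition oct_Re :: "octonion \<Rightarrow> real" where
  "oct_Re x = x $ 0"

definition oct_cnj :: "octonion \<Rightarrow> octonion" where
  "oct_cnj x = (\<chi> i. if i = 0 then x $ i else - x $ i)"

definition oct_partial :: "8 \<Rightarrow> (octonion \<Rightarrow> octonion) \<Rightarrow> octonion \<Rightarrow> octonion" where
  "oct_partial i f x = vector_derivative (\<lambda>t. f (x + t *\<^sub>R oct_e i)) (at 0)"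

definition oct_Dirac :: "(octonion \<Rightarrow> octonion) \<Rightarrow> octonion \<Rightarrow> octonion" where
  "oct_Dirac f x = (\<Sum>i\<in>UNIV. oct_e i \<odot> oct_partial i f x)"

definition C1_on :: "octonion set \<Rightarrow> (octonion \<Rightarrow> octonion) \<Rightarrow> bool" where
  "C1_on \<Omega> f \<longleftrightarrow>
     (\<exists>f' :: octonion \<Rightarrow> octonion \<Rightarrow>\<^sub>L octonion.
        (\<forall>x\<in>\<Omega>. (f has_derivative blinfun_apply (f' x)) (at x)) \<and> continuous_on \<Omega> f')"

definition left_oct_analytic_on :: "octonion set \<Rightarrow> (octonion \<Rightarrow> octonion) \<Rightarrow> bool" where
  "left_oct_analytic_on \<Omega> f \<longleftrightarrow> C1_on \<Omega> f \<and> (\<forall>x\<in>\<Omega>. oct_Dirac f x = 0)"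

definition oct_halfspace :: "octonion set" where
  "oct_halfspace = {x. oct_Re x > 0}"

text \<open>
  Functions on the half-space are represented by total functions whose values outside the
  half-space are irrelevant; equality in the Bergman space is equality on the half-space.
\<close>

definition oct_bergman_space :: "(octonion \<Rightarrow> octonion) set" where
  "oct_bergman_space =
     {f. left_oct_analytic_on oct_halfspace f \<and>
         set_integrable lborel oct_halfspace (\<lambda>x. (norm (f x))\<^sup>2)}"

text \<open>The surface area of the unit sphere in \<open>\<real>\<^sup>8\<close>.\<close>

definition omega8 :: real where
  "omega8 = pi ^ 4 / 3"

definition oct_bergman_inner ::
    "(octonion \<Rightarrow> octonion) \<Rightarrow> (octonion \<Rightarrow> octonion) \<Rightarrow> octonion" where
  "oct_bergman_inner f g =
     (1 / omega8) *\<^sub>R (LINT x:oct_halfspace|lborel. oct_cnj (g x) \<odot> f x)"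

definition is_oct_bergman_kernel :: "(octonion \<Rightarrow> octonion \<Rightarrow> octonion) \<Rightarrow> bool" where
  "is_oct_bergman_kernel K \<longleftrightarrow>
     (\<forall>a\<in>oct_halfspace.
        (\<lambda>x. K x a) \<in> oct_bergman_space \<and>
        (\<forall>f\<in>oct_bergman_space. f a = oct_bergman_inner f (\<lambda>x. K x a)))"

text \<open>The value at \<open>0\<close> is the junk value \<open>0\<close>; it is never used for \<open>x, a\<close> in the half-space.\<close>

definition oct_E :: "octonion \<Rightarrow> octonion" where
  "oct_E x = (1 / norm x ^ 8) *\<^sub>R oct_cnj x"

definition oct_B :: "octonion \<Rightarrow> octonion \<Rightarrow> octonion" where
  "oct_B x a = - 2 *\<^sub>R oct_partial 0 (\<lambda>y. oct_E (y + oct_cnj a)) x"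

end

theory Submission
  imports Defs
begin

text \<open>
  Let \<open>E\<close> be the Cauchy kernel.  The function
  \<open>\<theta>(x) = E(x - a) + cnj (E(x + cnj a))\<close> vanishes on the boundary of the half-space, since the
  two arguments are mirror images there up to sign, and alternativity gives, in the sense of
  distributions on the half-space,
  \<open>\<Sum>\<^sub>i (\<partial>\<^sub>i \<theta>) (e\<^sub>i w) = \<omega>\<^sub>8 \<delta>\<^sub>a w - cnj (B(x, a)) w\<close>.  Integrating the divergence of
  \<open>\<theta> (e\<^sub>i f)\<close> for left analytic \<open>f\<close> therefore yields the reproducing formula.  As \<open>f\<close> need not have boundary values,
  everything is multiplied by a cut-off \<open>\<zeta>\<close> whose gradient is \<open>O(1 / Re x)\<close>; since
  \<open>\<theta>\<close> is \<open>O(Re x)\<close> near the boundary, dominated convergence needs only that \<open>f\<close> and \<open>\<bar>x + cnj a\<bar>\<^sup>-\<^sup>8\<close> are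
  square integrable.
\<close>

section \<open>Octonion arithmetic\<close>

text \<open>The brackets in \<open>theta (e_i f)\<close> are forced. When the derivative falls on
  \<open>f\<close>, \<open>theta\<close> leaves the sum by linearity and \<open>Df = 0\<close>
  applies; the other half, \<open>(d_i theta) (e_i w)\<close>, cannot be regrouped and is evaluated
  for this particular \<open>theta\<close>. That succeeds because the derivatives of the two
  summands are combinations of the identity, the conjugation and rank-one maps along
  \<open>y\<close>, so only \<open>y (y w)\<close> and \<open>cnj y (y w)\<close> occur, which
  alternativity reduces. The factor \<open>-2\<close> and the direction \<open>e_0\<close> come from
  the mirror summand. With \<open>N y = y / |y|^8\<close>, the conjugate system
  \<open>Sum_i (d_i N) (cnj e_i w) = 0\<close> holds away from \<open>0\<close>. Since
  \<open>e_i + cnj e_i\<close> is \<open>2\<close> for \<open>i = 0\<close> and \<open>0\<close>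
  otherwise, replacing \<open>cnj e_i\<close> by \<open>e_i\<close> leaves exactly
  \<open>2 (d_0 N) w\<close>.\<close>

lemma UNIV_8: "(UNIV :: 8 set) = {0,1,2,3,4,5,6,7}"
proof (rule sym, rule card_subset_eq)
  show "card {0::8,1,2,3,4,5,6,7} = card (UNIV::8 set)" by simp
qed auto

lemma sum_8: "(\<Sum>i\<in>(UNIV::8 set). g i) = g 0 + g 1 + g 2 + g 3 + g 4 + g 5 + g 6 + g 7"
  for g :: "8 \<Rightarrow> 'a::comm_monoid_add"
  unfolding UNIV_8 by (simp add: add.assoc)

lemma neq_8:
  "0 \<noteq> (1::8)" "0 \<noteq> (2::8)" "0 \<noteq> (3::8)" "0 \<noteq> (4::8)" "0 \<noteq> (5::8)" "0 \<noteq> (6::8)" "0 \<noteq> (7::8)"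
  "1 \<noteq> (0::8)" "1 \<noteq> (2::8)" "1 \<noteq> (3::8)" "1 \<noteq> (4::8)" "1 \<noteq> (5::8)" "1 \<noteq> (6::8)" "1 \<noteq> (7::8)"
  "2 \<noteq> (0::8)" "2 \<noteq> (1::8)" "2 \<noteq> (3::8)" "2 \<noteq> (4::8)" "2 \<noteq> (5::8)" "2 \<noteq> (6::8)" "2 \<noteq> (7::8)"
  "3 \<noteq> (0::8)" "3 \<noteq> (1::8)" "3 \<noteq> (2::8)" "3 \<noteq> (4::8)" "3 \<noteq> (5::8)" "3 \<noteq> (6::8)" "3 \<noteq> (7::8)"
  "4 \<noteq> (0::8)" "4 \<noteq> (1::8)" "4 \<noteq> (2::8)" "4 \<noteq> (3::8)" "4 \<noteq> (5::8)" "4 \<noteq> (6::8)" "4 \<noteq> (7::8)"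
  "5 \<noteq> (0::8)" "5 \<noteq> (1::8)" "5 \<noteq> (2::8)" "5 \<noteq> (3::8)" "5 \<noteq> (4::8)" "5 \<noteq> (6::8)" "5 \<noteq> (7::8)"
  "6 \<noteq> (0::8)" "6 \<noteq> (1::8)" "6 \<noteq> (2::8)" "6 \<noteq> (3::8)" "6 \<noteq> (4::8)" "6 \<noteq> (5::8)" "6 \<noteq> (7::8)"
  "7 \<noteq> (0::8)" "7 \<noteq> (1::8)" "7 \<noteq> (2::8)" "7 \<noteq> (3::8)" "7 \<noteq> (4::8)" "7 \<noteq> (5::8)" "7 \<noteq> (6::8)"
  by simp_all

lemma in_oct_W:
  "(1,2,3) \<in> oct_W" "(1,4,5) \<in> oct_W" "(1,7,6) \<in> oct_W" "(2,4,6) \<in> oct_W" "(2,5,7) \<in> oct_W" "(3,4,7) \<in> oct_W" "(3,6,5) \<in> oct_W"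
  unfolding oct_W_def by (intro insertI1 insertI2)+

lemmas oct_basis_products =
  oct_mult_unit oct_mult_square
  oct_mult_W[OF in_oct_W(1)]
  oct_mult_W[OF in_oct_W(2)]
  oct_mult_W[OF in_oct_W(3)]
  oct_mult_W[OF in_oct_W(4)]
  oct_mult_W[OF in_oct_W(5)]
  oct_mult_W[OF in_oct_W(6)]
  oct_mult_W[OF in_oct_W(7)]

lemma oct_mult_expand: "x \<odot> y = (\<Sum>i\<in>UNIV. \<Sum>j\<in>UNIV. (x$i * y$j) *\<^sub>R (oct_e i \<odot> oct_e j))"
  unfolding oct_mult_basis by (simp add: oct_mult_def vec_eq_iff)

lemma oct_e_nth: "oct_e i $ j = (if j = i then 1 else 0)"
  by (simp add: axis_def)

text \<open>With products in coordinates, alternativity and adjointness become polynomial identities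
  that can be checked by expansion.\<close>

lemma oct_mult_nth:
  "(x \<odot> y) $ 0 = x$0 * y$0 - x$1 * y$1 - x$2 * y$2 - x$3 * y$3 - x$4 * y$4 - x$5 * y$5 - x$6 * y$6 - x$7 * y$7"
  "(x \<odot> y) $ 1 = x$0 * y$1 + x$1 * y$0 + x$2 * y$3 - x$3 * y$2 + x$4 * y$5 - x$5 * y$4 + x$7 * y$6 - x$6 * y$7"
  "(x \<odot> y) $ 2 = x$0 * y$2 + x$2 * y$0 + x$3 * y$1 - x$1 * y$3 + x$4 * y$6 - x$6 * y$4 + x$5 * y$7 - x$7 * y$5"
  "(x \<odot> y) $ 3 = x$0 * y$3 + x$3 * y$0 + x$1 * y$2 - x$2 * y$1 + x$4 * y$7 - x$7 * y$4 + x$6 * y$5 - x$5 * y$6"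
  "(x \<odot> y) $ 4 = x$0 * y$4 + x$4 * y$0 + x$5 * y$1 - x$1 * y$5 + x$6 * y$2 - x$2 * y$6 + x$7 * y$3 - x$3 * y$7"
  "(x \<odot> y) $ 5 = x$0 * y$5 + x$5 * y$0 + x$1 * y$4 - x$4 * y$1 + x$7 * y$2 - x$2 * y$7 + x$3 * y$6 - x$6 * y$3"
  "(x \<odot> y) $ 6 = x$0 * y$6 + x$6 * y$0 + x$1 * y$7 - x$7 * y$1 + x$2 * y$4 - x$4 * y$2 + x$5 * y$3 - x$3 * y$5"
  "(x \<odot> y) $ 7 = x$0 * y$7 + x$7 * y$0 + x$6 * y$1 - x$1 * y$6 + x$2 * y$5 - x$5 * y$2 + x$3 * y$4 - x$4 * y$3"
  unfolding oct_mult_expand[of x y] sum_8 by (simp_all only: oct_basis_products neq_8 not_False_eq_True vector_add_component vector_scaleR_component vector_uminus_component oct_e_nth if_True if_False mult_1_right mult_zero_right mult_minus_right add_0_left add_0_right) simp_all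

lemma all_8: "(\<forall>i::8. Q i) \<longleftrightarrow> Q 0 \<and> Q 1 \<and> Q 2 \<and> Q 3 \<and> Q 4 \<and> Q 5 \<and> Q 6 \<and> Q 7"
proof -
  have "(\<forall>i::8. Q i) \<longleftrightarrow> (\<forall>i\<in>UNIV. Q i)" by simp
  then show ?thesis unfolding UNIV_8 by simp
qed

lemma oct_cnj_nth: "oct_cnj x $ i = (if i = 0 then x $ i else - x $ i)"
  by (simp add: oct_cnj_def)

lemma norm_oct_sq:
  "(norm (x::octonion))\<^sup>2 = (x$0)\<^sup>2 + (x$1)\<^sup>2 + (x$2)\<^sup>2 + (x$3)\<^sup>2 + (x$4)\<^sup>2 + (x$5)\<^sup>2 + (x$6)\<^sup>2 + (x$7)\<^sup>2"
  by (simp add: norm_vec_def L2_set_def sum_nonneg sum_8)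

text \<open>The form of alternativity from which the later rules for norms and for repeated factors
  are derived: a factor next to its conjugate may be rebracketed.\<close>

lemma oct_cnj_mult_mult: "oct_cnj x \<odot> (x \<odot> y) = (norm x)\<^sup>2 *\<^sub>R y"
  unfolding vec_eq_iff all_8 norm_oct_sq
  by (simp add: oct_mult_nth oct_cnj_nth power2_eq_square algebra_simps)

lemma inner_oct: "inner (x::octonion) y = x$0*y$0 + x$1*y$1 + x$2*y$2 + x$3*y$3 + x$4*y$4 + x$5*y$5 + x$6*y$6 + x$7*y$7"
  by (simp add: inner_vec_def sum_8)

lemma inner_oct_mult_left: "inner (x \<odot> y) z = inner y (oct_cnj x \<odot> z)"
  unfolding inner_oct oct_mult_nth by (simp add: oct_cnj_nth algebra_simps)

text \<open>Left multiplication by \<open>oct_cnj x\<close> is adjoint to left multiplication by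
  \<open>x\<close>, so alternativity evaluates the squared norm.\<close>

lemma norm_oct_mult: "norm (x \<odot> y) = norm x * norm y"
proof -
  have "(norm (x \<odot> y))\<^sup>2 = (norm x * norm y)\<^sup>2"
    by (simp add: power2_norm_eq_inner inner_oct_mult_left oct_cnj_mult_mult power_mult_distrib)
  then show ?thesis by simp
qed

section \<open>Integration lemmas\<close>

text \<open>
  Difference quotients have integral zero by translation invariance and are dominated by the
  Lipschitz bound, so neither Fubini's theorem nor smoothness is needed.
\<close>

lemma integral_divergence_eq_0:
  fixes \<phi> :: "'i \<Rightarrow> 'a::euclidean_space \<Rightarrow> 'b::euclidean_space"
  assumes lip: "\<And>i. i \<in> I \<Longrightarrow> L-lipschitz_on UNIV (\<phi> i)"
    and supp: "\<And>i x. i \<in> I \<Longrightarrow> R < norm x \<Longrightarrow> \<phi> i x = 0"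
    and der: "AE x in lborel. \<exists>d. (\<forall>i\<in>I. ((\<lambda>t. \<phi> i (x + t *\<^sub>R v i)) has_vector_derivative d i) (at 0)) \<and> (\<Sum>i\<in>I. d i) = g x"
    and meas: "g \<in> borel_measurable borel"
  shows "integral\<^sup>L lborel g = 0"
proof -
  show ?thesis
  proof (cases "finite I \<and> I \<noteq> {}")
    case False
    \<comment> \<open>A sum over an empty or an infinite index set is \<open>0\<close>, so
      \<open>g\<close> vanishes almost everywhere.\<close>
    then have "AE x in lborel. g x = 0" using der by (cases "finite I") auto
    then show ?thesis by (simp add: integral_eq_zero_AE)
  next
    case True
    then have fin: "finite I" and L: "0 \<le> L" using lip lipschitz_on_nonneg by blast+
    have cont: "continuous_on UNIV (\<phi> i)" if "i \<in> I" for i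
      using lip[OF that] by (rule lipschitz_on_continuous_on)
    have meas\<phi>: "\<phi> i \<in> borel_measurable borel" if "i \<in> I" for i
      using cont[OF that] by (rule borel_measurable_continuous_onI)
    have int: "integrable lborel (\<phi> i)" if "i \<in> I" for i
    proof -
      have "integrable lborel (\<lambda>x. indicator (cball 0 R) x *\<^sub>R \<phi> i x)"
        by (intro borel_integrable_compact compact_cball continuous_on_subset[OF cont[OF that]]) auto
      also have "(\<lambda>x. indicator (cball 0 R) x *\<^sub>R \<phi> i x) = \<phi> i"
        using supp[OF that] by (auto simp: indicator_def fun_eq_iff)
      finally show ?thesis .
    qed
    have shift: "integrable lborel (\<lambda>x. \<phi> i (c + x))" "(\<integral>x. \<phi> i (c + x) \<partial>lborel) = integral\<^sup>L lborel (\<phi> i)"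
      if "i \<in> I" for i c
    proof -
      have "integrable (distr lborel borel ((+) c)) (\<phi> i)"
        "integral\<^sup>L (distr lborel borel ((+) c)) (\<phi> i) = integral\<^sup>L lborel (\<phi> i)"
        using int[OF that] by (simp_all add: lborel_distr_plus)
      then show "integrable lborel (\<lambda>x. \<phi> i (c + x))" "(\<integral>x. \<phi> i (c + x) \<partial>lborel) = integral\<^sup>L lborel (\<phi> i)"
        using meas\<phi>[OF that] by (simp_all add: integrable_distr_eq integral_distr)
    qed
    define s where "s i n x = real (Suc n) *\<^sub>R (\<phi> i (inverse (real (Suc n)) *\<^sub>R v i + x) - \<phi> i x)" for i n x
    have int_s: "integrable lborel (s i n)" "integral\<^sup>L lborel (s i n) = 0" if "i \<in> I" for i n
      unfolding s_def using int[OF that] shift[OF that] by simp_all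
    \<comment> \<open>The step lengths \<open>inverse (real (Suc n))\<close> are at most
      \<open>1\<close>, so every shifted support stays in the ball of radius
      \<open>R + norm (v i)\<close>, and one majorant serves all \<open>n\<close>.\<close>
    let ?w = "\<lambda>x. \<Sum>i\<in>I. indicator (cball 0 (R + norm (v i))) x *\<^sub>R (L * norm (v i))"
    have conv: "AE x in lborel. (\<lambda>n. \<Sum>i\<in>I. s i n x) \<longlonglongrightarrow> g x"
      using der
    proof eventually_elim
      fix x
      assume "\<exists>d. (\<forall>i\<in>I. ((\<lambda>t. \<phi> i (x + t *\<^sub>R v i)) has_vector_derivative d i) (at 0)) \<and> (\<Sum>i\<in>I. d i) = g x"
      then obtain d where d: "\<And>i. i \<in> I \<Longrightarrow> ((\<lambda>t. \<phi> i (x + t *\<^sub>R v i)) has_vector_derivative d i) (at 0)"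
        and g: "g x = (\<Sum>i\<in>I. d i)" by metis
      have "(\<lambda>n. s i n x) \<longlonglongrightarrow> d i" if "i \<in> I" for i
      proof -
        have "((\<lambda>h. norm (\<phi> i (x + h *\<^sub>R v i) - \<phi> i x - h *\<^sub>R d i) / norm h) \<longlongrightarrow> 0) (at 0)"
          using d[OF that] by (simp add: has_vector_derivative_def has_derivative_at)
        moreover have "filterlim (\<lambda>n. inverse (real (Suc n))) (at 0) sequentially"
          using LIMSEQ_inverse_real_of_nat by (auto simp: filterlim_at)
        ultimately have "(\<lambda>n. norm (\<phi> i (x + inverse (real (Suc n)) *\<^sub>R v i) - \<phi> i x - inverse (real (Suc n)) *\<^sub>R d i)
            / norm (inverse (real (Suc n)))) \<longlonglongrightarrow> 0"
          by (rule filterlim_compose)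
        moreover have "norm (\<phi> i (x + inverse (real (Suc n)) *\<^sub>R v i) - \<phi> i x - inverse (real (Suc n)) *\<^sub>R d i)
            / norm (inverse (real (Suc n))) = norm (s i n x - d i)" for n
        proof -
          have "s i n x - d i = real (Suc n) *\<^sub>R (\<phi> i (x + inverse (real (Suc n)) *\<^sub>R v i) - \<phi> i x - inverse (real (Suc n)) *\<^sub>R d i)"
            by (simp add: s_def scaleR_diff_right add.commute)
          then have "norm (s i n x - d i) = real (Suc n) * norm (\<phi> i (x + inverse (real (Suc n)) *\<^sub>R v i) - \<phi> i x - inverse (real (Suc n)) *\<^sub>R d i)"
            by simp
          then show ?thesis by (simp add: divide_inverse mult.commute)
        qed
        ultimately have "(\<lambda>n. norm (s i n x - d i)) \<longlonglongrightarrow> 0" by simp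
        then show "(\<lambda>n. s i n x) \<longlonglongrightarrow> d i"
          by (simp only: tendsto_norm_zero_iff LIM_zero_iff)
      qed
      then show "(\<lambda>n. \<Sum>i\<in>I. s i n x) \<longlonglongrightarrow> g x"
        unfolding g by (rule tendsto_sum)
    qed
    have bound: "norm (s i n x) \<le> indicator (cball 0 (R + norm (v i))) x *\<^sub>R (L * norm (v i))" if "i \<in> I" for i n x
    proof (cases "norm x \<le> R + norm (v i)")
      case True
      have "norm (\<phi> i (inverse (real (Suc n)) *\<^sub>R v i + x) - \<phi> i x) \<le> L * norm (inverse (real (Suc n)) *\<^sub>R v i)"
        using lipschitz_onD[OF lip[OF that], of "inverse (real (Suc n)) *\<^sub>R v i + x" x] by (simp add: dist_norm)
      also have "\<dots> = inverse (real (Suc n)) * (L * norm (v i))" by simp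
      finally have "real (Suc n) * norm (\<phi> i (inverse (real (Suc n)) *\<^sub>R v i + x) - \<phi> i x) \<le> L * norm (v i)"
        by (simp add: field_simps)
      then show ?thesis using True by (simp add: s_def)
    next
      case False
      have "norm (v i) \<le> real (Suc n) * norm (v i)" by (simp add: algebra_simps)
      then have "norm (inverse (real (Suc n)) *\<^sub>R v i) \<le> norm (v i)" by (simp add: field_simps)
      moreover have "norm x - norm (inverse (real (Suc n)) *\<^sub>R v i) \<le> norm (inverse (real (Suc n)) *\<^sub>R v i + x)"
        by (metis add.commute norm_diff_ineq)
      ultimately have "R < norm (inverse (real (Suc n)) *\<^sub>R v i + x)" "R < norm x"
        using False norm_ge_zero[of "v i"] by linarith+
      then have "\<phi> i (inverse (real (Suc n)) *\<^sub>R v i + x) = 0" "\<phi> i x = 0"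
        by (simp_all only: supp[OF that])
      then show ?thesis using L by (simp add: s_def)
    qed
    have w: "integrable lborel ?w"
      by (intro Bochner_Integration.integrable_sum borel_integrable_compact) auto
    have "(\<lambda>n. \<integral>x. (\<Sum>i\<in>I. s i n x) \<partial>lborel) \<longlonglongrightarrow> integral\<^sup>L lborel g"
    proof (rule integral_dominated_convergence[OF _ _ w conv])
      show "AE x in lborel. norm (\<Sum>i\<in>I. s i n x) \<le> ?w x" for n
        by (intro AE_I2 sum_norm_le bound)
      show "(\<lambda>x. \<Sum>i\<in>I. s i n x) \<in> borel_measurable lborel" for n
        by (intro borel_measurable_integrable Bochner_Integration.integrable_sum int_s)
    qed (use meas in simp)
    then show "integral\<^sup>L lborel g = 0"
      using int_s by (simp add: LIMSEQ_const_iff)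
  qed
qed

text \<open>Dyadic majorant: on the shell between radii \<open>2 ^ k * r\<close> and
  \<open>2 ^ Suc k * r\<close> the function is at most \<open>(2 ^ k * r) ^ -p\<close>. Extending
  this bound to the whole ball costs only a constant, and the integrals form a geometric series with
  ratio \<open>q = 2 ^ DIM('a) / 2 ^ p < 1\<close>.\<close>

lemma integrable_inverse_norm_power:
  assumes r: "0 < r" and p: "DIM('a) < p"
  shows "integrable lborel (\<lambda>x::'a::euclidean_space. indicator {x. r \<le> norm x} x / norm x ^ p)"
proof -
  define f :: "nat \<Rightarrow> 'a \<Rightarrow> real" where
    "f k x = indicator (ball 0 (2 ^ Suc k * r)) x * inverse ((2 ^ k * r) ^ p)" for k x
  define q :: real where "q = 2 ^ DIM('a) / 2 ^ p"
  have "(2::real) ^ DIM('a) < 2 ^ p" using p by simp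
  then have q: "0 \<le> q" "q < 1" by (auto simp: q_def divide_simps)
  have f0: "0 \<le> f k x" for k x using r by (simp add: f_def)
  have intf: "integrable lborel (f k)" for k
    unfolding f_def by (intro integrable_mult_left integrable_real_indicator) (auto simp: emeasure_lborel_ball_finite[unfolded infinity_ennreal_def])
  have If: "integral\<^sup>L lborel (f k) = unit_ball_vol (DIM('a)) * (2 * r) ^ DIM('a) / r ^ p * q ^ k" for k
  proof -
    have "integral\<^sup>L lborel (f k) = measure lborel (ball (0::'a) (2 ^ Suc k * r)) * inverse ((2 ^ k * r) ^ p)"
      unfolding f_def by simp
    also have "measure lborel (ball (0::'a) (2 ^ Suc k * r)) = unit_ball_vol (DIM('a)) * (2 ^ Suc k * r) ^ DIM('a)"
      using r by (simp add: content_ball del: power_Suc)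
    finally show ?thesis
      by (simp add: q_def power_mult_distrib power_divide field_simps power_mult[symmetric])
  qed
  have summf: "summable (\<lambda>k. f k x)" for x
  proof (rule summable_comparison_test')
    show "summable (\<lambda>k. inverse (r ^ p) * inverse (2 ^ p :: real) ^ k)"
      using p by (intro summable_mult summable_geometric) (auto simp: divide_simps)
    show "norm (f k x) \<le> inverse (r ^ p) * inverse (2 ^ p) ^ k" for k
      using r by (auto simp: f_def indicator_def power_mult_distrib power_mult[symmetric] power_inverse mult.commute)
  qed
  have "integrable lborel (\<lambda>x. \<Sum>k. f k x)"
  proof (rule integrable_suminf[OF intf])
    show "AE x in lborel. summable (\<lambda>k. norm (f k x))"
      using summf f0 by simp
    show "summable (\<lambda>k. \<integral>x. norm (f k x) \<partial>lborel)"
      using f0 q by (simp add: If summable_mult)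
  qed
  then show ?thesis
  proof (rule Bochner_Integration.integrable_bound)
    show "(\<lambda>x::'a. indicator {x. r \<le> norm x} x / norm x ^ p) \<in> borel_measurable lborel"
      by measurable
    have "indicator {x. r \<le> norm x} x / norm x ^ p \<le> (\<Sum>k. f k x)" for x :: 'a
    proof (cases "r \<le> norm x")
      case True
      obtain n where "norm x / r < 2 ^ n"
        using real_arch_pow[of 2 "norm x / r"] by auto
      then have ex: "norm x < 2 ^ n * r" using r by (simp add: field_simps)
      \<comment> \<open>Since \<open>r \<le> norm x\<close> excludes \<open>m = 0\<close>, the
        predecessor \<open>k\<close> exists and indexes the shell of \<open>x\<close>; its single
        term already bounds the function.\<close>
      define m where "m = (LEAST n. norm x < 2 ^ n * r)"
      have m: "norm x < 2 ^ m * r" unfolding m_def using ex by (rule LeastI)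
      with True obtain k where k: "m = Suc k" by (cases m) auto
      have "\<not> norm x < 2 ^ k * r"
        using k unfolding m_def by (metis lessI not_less_Least)
      then have "inverse (norm x ^ p) \<le> f k x"
        using m k r by (auto simp: f_def intro!: le_imp_inverse_le power_mono)
      also have "\<dots> \<le> (\<Sum>k. f k x)"
        using sum_le_suminf[OF summf, of "{k}" x] f0 by simp
      finally show ?thesis using True by (simp add: divide_inverse)
    next
      case False
      then show ?thesis using suminf_nonneg[OF summf f0] by simp
    qed
    then show "AE x in lborel. norm (indicator {x. r \<le> norm x} x / norm x ^ p) \<le> norm (\<Sum>k. f k x)"
      by (auto intro!: AE_I2 simp: suminf_nonneg[OF summf f0])
  qed
qed

lemma lipschitz_on_UNIV_derivative:
  fixes u :: "'a::euclidean_space \<Rightarrow> 'b::real_normed_vector"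
  assumes der: "\<And>x. (u has_derivative u' x) (at x)"
    and bound: "\<And>x h. norm (u' x h) \<le> C * norm h" "0 \<le> C"
  shows "C-lipschitz_on UNIV u"
proof (rule lipschitz_onI)
  fix x y :: 'a
  show "dist (u x) (u y) \<le> C * dist x y"
    unfolding dist_norm
    using der bound by (intro differentiable_bound[of UNIV u u']) (auto intro: onorm_le)
qed fact

section \<open>Conjugation, norm and alternativity\<close>

interpretation oct_mult: bounded_bilinear "(\<odot>)"
  using bilinear_oct_mult by (simp add: bilinear_conv_bounded_bilinear)

declare oct_mult.zero_left [simp] oct_mult.zero_right [simp]

lemma bounded_linear_oct_cnj: "bounded_linear oct_cnj"
  by (intro linear_conv_bounded_linear[THEN iffD1] linearI) (auto simp: oct_cnj_def vec_eq_iff)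

lemma oct_cnj_scaleR: "oct_cnj (c *\<^sub>R x) = c *\<^sub>R oct_cnj x"
  and oct_cnj_minus: "oct_cnj (- x) = - oct_cnj x"
  and oct_cnj_diff: "oct_cnj (x - y) = oct_cnj x - oct_cnj y"
  by (simp_all add: oct_cnj_def vec_eq_iff)

lemma oct_cnj_cnj [simp]: "oct_cnj (oct_cnj x) = x"
  by (simp add: oct_cnj_def vec_eq_iff)

lemma oct_cnj_one [simp]: "oct_cnj (oct_e 0) = oct_e 0"
  by (auto simp: oct_cnj_def axis_def vec_eq_iff)

lemma norm_oct_cnj [simp]: "norm (oct_cnj x) = norm x"
  by (simp add: norm_eq_sqrt_inner inner_oct oct_cnj_nth neq_8)

lemma oct_add_cnj: "x + oct_cnj x = (2 * x $ 0) *\<^sub>R oct_e 0"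
  by (auto simp: oct_cnj_def axis_def vec_eq_iff)

lemma oct_mult_one [simp]: "oct_e 0 \<odot> x = x" "x \<odot> oct_e 0 = x"
  unfolding vec_eq_iff all_8 by (simp_all add: oct_mult_nth oct_e_nth neq_8)

lemma oct_mult_cnj_mult: "x \<odot> (oct_cnj x \<odot> y) = (norm x)\<^sup>2 *\<^sub>R y"
  using oct_cnj_mult_mult[of "oct_cnj x" y] by simp

lemma oct_mult_cnj: "x \<odot> oct_cnj x = (norm x)\<^sup>2 *\<^sub>R oct_e 0"
  using oct_mult_cnj_mult[of x "oct_e 0"] by simp

lemma oct_cnj_mult: "oct_cnj x \<odot> x = (norm x)\<^sup>2 *\<^sub>R oct_e 0"
  using oct_cnj_mult_mult[of x "oct_e 0"] by simp

text \<open>Substitute \<open>oct_cnj x = 2 x_0 - x\<close> in \<open>oct_cnj_mult_mult\<close>; the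
  sum \<open>x + oct_cnj x\<close> is real and associates with everything.\<close>

lemma oct_mult_mult_self: "x \<odot> (x \<odot> y) = (2 * x $ 0) *\<^sub>R (x \<odot> y) - (norm x)\<^sup>2 *\<^sub>R y"
proof -
  have "(x + oct_cnj x) \<odot> (x \<odot> y) = (2 * x $ 0) *\<^sub>R (x \<odot> y)"
    by (simp add: oct_add_cnj oct_mult.scaleR_left)
  then show ?thesis
    by (simp add: oct_mult.add_left oct_cnj_mult_mult algebra_simps)
qed

lemma oct_expansion: "(\<Sum>i\<in>UNIV. x $ i *\<^sub>R oct_e i) = x"
  by (simp add: basis_expansion scalar_mult_eq_scaleR[symmetric])

lemma inner_oct_e [simp]: "x \<bullet> oct_e i = x $ i" "oct_e i \<bullet> x = x $ i"
  by (simp_all add: inner_axis inner_axis')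

lemma norm_oct_e [simp]: "norm (oct_e i) = 1"
  by (simp add: norm_eq_1 inner_axis_axis)

text \<open>
  For \<open>T\<close> the derivative of \<open>\<theta>\<close> at a point, this is \<open>\<Sum>\<^sub>i (\<partial>\<^sub>i \<theta>) (e\<^sub>i w)\<close>, the source term in the divergence of
  \<open>\<theta> (e\<^sub>i f)\<close>; multiplication is not associative, so \<open>w\<close> cannot be split off.
\<close>

definition oct_source :: "(octonion \<Rightarrow> octonion) \<Rightarrow> octonion \<Rightarrow> octonion" where
  "oct_source T w = (\<Sum>i\<in>UNIV. T (oct_e i) \<odot> (oct_e i \<odot> w))"

lemma oct_source_add: "oct_source (\<lambda>h. S h + T h) w = oct_source S w + oct_source T w"
  by (simp add: oct_source_def oct_mult.add_left sum.distrib)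

lemma oct_source_diff: "oct_source (\<lambda>h. S h - T h) w = oct_source S w - oct_source T w"
  by (simp add: oct_source_def oct_mult.diff_left sum_subtractf)

lemma oct_source_scaleR: "oct_source (\<lambda>h. c *\<^sub>R T h) w = c *\<^sub>R oct_source T w"
  by (simp add: oct_source_def oct_mult.scaleR_left scaleR_sum_right)

text \<open>For a rank-one derivative the coordinates of \<open>y\<close> reassemble
  \<open>y\<close> inside the inner bracket, so bilinearity suffices and nothing is
  rebracketed.\<close>

lemma oct_source_inner: "oct_source (\<lambda>h. (y \<bullet> h) *\<^sub>R z) w = z \<odot> (y \<odot> w)"
proof -
  have "z \<odot> (y \<odot> w) = z \<odot> ((\<Sum>i\<in>UNIV. y $ i *\<^sub>R oct_e i) \<odot> w)"
    by (simp only: oct_expansion)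
  then show ?thesis
    by (simp add: oct_source_def oct_mult.sum_left oct_mult.sum_right oct_mult.scaleR_left oct_mult.scaleR_right)
qed

lemma oct_source_cnj: "oct_source oct_cnj w = 8 *\<^sub>R w"
  by (simp add: oct_source_def oct_cnj_mult_mult vec_eq_iff)

lemma oct_e_mult_mult: "oct_e i \<odot> (oct_e i \<odot> w) = (if i = 0 then w else - w)"
  using oct_mult_mult_self[of "oct_e i" w] by (auto simp: oct_e_nth vec_eq_iff)

text \<open>The real unit contributes \<open>w\<close> and each of the seven imaginary units
  \<open>- w\<close>, hence \<open>1 - 7 = - 6\<close>.\<close>

lemma oct_source_id: "oct_source (\<lambda>h. h) w = - (6 *\<^sub>R w)"
  by (simp add: oct_source_def oct_e_mult_mult sum_8 neq_8 vec_eq_iff)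

lemma has_derivative_inverse_inner_power:
  fixes y :: "'a::real_inner"
  assumes "y \<noteq> 0"
  shows "((\<lambda>y. 1 / (y \<bullet> y) ^ Suc n) has_derivative (\<lambda>h. - (2 * real (Suc n) * (y \<bullet> h) / (y \<bullet> y) ^ Suc (Suc n)))) (at y)"
  using assms
  by (auto intro!: derivative_eq_intros simp del: power_Suc simp: inner_commute field_simps)
     (auto simp: fun_eq_iff field_simps)

text \<open>The derivative of \<open>y / \<bar>y\<bar>\<^sup>8\<close>, which is the conjugate of \<open>oct_E y\<close>.\<close>

definition oct_dE :: "octonion \<Rightarrow> octonion \<Rightarrow> octonion" where
  "oct_dE y h = (1 / (y \<bullet> y) ^ 4) *\<^sub>R h - (8 / (y \<bullet> y) ^ 5) *\<^sub>R ((y \<bullet> h) *\<^sub>R y)"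

lemma norm_power_8: "norm y ^ 8 = (y \<bullet> y) ^ 4"
  by (simp add: power2_norm_eq_inner[symmetric] power_mult[symmetric])

lemma has_derivative_oct_cnj_E:
  assumes "y \<noteq> 0"
  shows "((\<lambda>y. (1 / norm y ^ 8) *\<^sub>R y) has_derivative oct_dE y) (at y)"
  unfolding norm_power_8
  using has_derivative_scaleR[OF has_derivative_inverse_inner_power[OF assms, of 3] has_derivative_ident]
  by (simp add: oct_dE_def[abs_def] algebra_simps)

text \<open>Reducing \<open>y (y w)\<close> to \<open>2 y_0 (y w) - |y|^2 w\<close> adds
  \<open>8 / |y|^8\<close> to the \<open>- 6 / |y|^8\<close> of the identity part. What is left,
  \<open>2 / |y|^8\<close> and \<open>- 16 y_0 y / |y|^10\<close>, is twice the derivative in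
  direction \<open>e_0\<close>.\<close>

lemma oct_source_dE:
  assumes "y \<noteq> 0"
  shows "oct_source (oct_dE y) w = 2 *\<^sub>R (oct_dE y (oct_e 0) \<odot> w)"
proof -
  have "y \<bullet> y \<noteq> 0" using assms by simp
  have "oct_source (oct_dE y) w = - ((6 / (y \<bullet> y) ^ 4) *\<^sub>R w) - (8 / (y \<bullet> y) ^ 5) *\<^sub>R (y \<odot> (y \<odot> w))"
    unfolding oct_dE_def[abs_def] oct_source_diff oct_source_scaleR oct_source_id oct_source_inner by simp
  also have "\<dots> = 2 *\<^sub>R (oct_dE y (oct_e 0) \<odot> w)"
    using assms unfolding oct_mult_mult_self power2_norm_eq_inner
    by (simp add: oct_dE_def oct_mult.diff_left oct_mult.scaleR_left scaleR_diff_right scaleR_left_distrib[symmetric]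
       power_eq_if algebra_simps)
  finally show ?thesis .
qed

section \<open>The kernel\<close>

lemma oct_E_eq: "oct_E y = oct_cnj ((1 / norm y ^ 8) *\<^sub>R y)"
  by (simp add: oct_E_def oct_cnj_scaleR)

lemma has_vector_derivative_along_line:
  assumes "(f has_derivative f') (at x)"
  shows "((\<lambda>t. f (x + t *\<^sub>R v)) has_vector_derivative f' v) (at 0)"
proof -
  have "((\<lambda>t. x + t *\<^sub>R v) has_derivative (\<lambda>t. t *\<^sub>R v)) (at (0::real))"
    by (auto intro!: derivative_eq_intros)
  moreover have "(f has_derivative f') (at (x + 0 *\<^sub>R v))" using assms by simp
  ultimately have "((\<lambda>t. f (x + t *\<^sub>R v)) has_derivative (\<lambda>t. f' (t *\<^sub>R v))) (at (0::real))"
    by (rule has_derivative_compose)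
  moreover have "f' (t *\<^sub>R v) = t *\<^sub>R f' v" for t
    by (rule linear_cmul[OF has_derivative_linear[OF assms]])
  ultimately show ?thesis
    by (simp add: has_vector_derivative_def)
qed

lemma oct_partial_eq:
  assumes "(f has_derivative f') (at x)"
  shows "oct_partial i f x = f' (oct_e i)"
  unfolding oct_partial_def by (rule vector_derivative_at[OF has_vector_derivative_along_line[OF assms]])

lemma oct_Dirac_eq:
  assumes "(f has_derivative f') (at x)"
  shows "oct_Dirac f x = (\<Sum>i\<in>UNIV. oct_e i \<odot> f' (oct_e i))"
  by (simp add: oct_Dirac_def oct_partial_eq[OF assms])

lemma oct_B_eq_dE:
  assumes "x + oct_cnj a \<noteq> 0"
  shows "oct_B x a = - 2 *\<^sub>R oct_cnj (oct_dE (x + oct_cnj a) (oct_e 0))"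
proof -
  have "((\<lambda>y. y + oct_cnj a) has_derivative (\<lambda>h. h)) (at x)"
    by (auto intro!: derivative_eq_intros)
  then have "((\<lambda>y. oct_E (y + oct_cnj a)) has_derivative (\<lambda>h. oct_cnj (oct_dE (x + oct_cnj a) h))) (at x)"
    unfolding oct_E_eq
    by (rule bounded_linear.has_derivative[OF bounded_linear_oct_cnj has_derivative_compose])
       (rule has_derivative_oct_cnj_E[OF assms])
  from oct_partial_eq[OF this, of 0] show ?thesis
    by (simp add: oct_B_def)
qed

lemma oct_source_dE_eq_B:
  assumes "x + oct_cnj a \<noteq> 0"
  shows "oct_source (oct_dE (x + oct_cnj a)) w = - (oct_cnj (oct_B x a) \<odot> w)"
  unfolding oct_source_dE[OF assms] oct_B_eq_dE[OF assms]
  by (simp add: oct_cnj_minus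
      oct_cnj_scaleR oct_mult.minus_left oct_mult.scaleR_left)

lemma oct_B_eq:
  assumes "x + oct_cnj a \<noteq> 0"
  defines "y \<equiv> x + oct_cnj a"
  shows "oct_B x a = (- 2 / (y \<bullet> y) ^ 4) *\<^sub>R oct_e 0 + (16 * (y $ 0) / (y \<bullet> y) ^ 5) *\<^sub>R oct_cnj y"
  unfolding oct_B_eq_dE[OF assms(1)] y_def[symmetric]
  by (simp add: oct_dE_def oct_cnj_scaleR
      oct_cnj_diff scaleR_diff_right)

lemma norm_oct_B_le:
  assumes "x + oct_cnj a \<noteq> 0"
  shows "norm (oct_B x a) \<le> 18 / norm (x + oct_cnj a) ^ 8"
proof -
  define y where "y = x + oct_cnj a"
  have y: "y \<noteq> 0" using assms by (simp add: y_def)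
  have "norm (oct_B x a) \<le> norm ((- 2 / (y \<bullet> y) ^ 4) *\<^sub>R oct_e 0) + norm ((16 * (y $ 0) / (y \<bullet> y) ^ 5) *\<^sub>R oct_cnj y)"
    unfolding oct_B_eq[OF assms] y_def[symmetric] by (rule norm_triangle_ineq)
  also have "norm ((16 * (y $ 0) / (y \<bullet> y) ^ 5) *\<^sub>R oct_cnj y) = 16 * (\<bar>y $ 0\<bar> * norm y) / (y \<bullet> y) ^ 5"
    by (simp add: abs_mult)
  also have "\<dots> \<le> 16 * (norm y * norm y) / (y \<bullet> y) ^ 5"
    by (intro divide_right_mono mult_left_mono mult_right_mono component_le_norm_cart) auto
  also have "\<dots> = 16 / (y \<bullet> y) ^ 4"
    using y by (simp add: norm_eq_sqrt_inner power_eq_if)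
  also have "norm ((- 2 / (y \<bullet> y) ^ 4) *\<^sub>R oct_e 0) = 2 / (y \<bullet> y) ^ 4"
    by simp
  finally show ?thesis
    using y by (simp add: norm_power_8 y_def[symmetric] add_divide_distrib[symmetric])
qed

text \<open>The derivative of the closed form in \<open>oct_B_eq\<close>, as a function of
  \<open>y = x + oct_cnj a\<close>: differentiating the fourth and fifth inverse powers of
  \<open>y \<bullet> y\<close> gives \<open>(- 2) * (- 8) = 16\<close> and
  \<open>16 * (- 10) = - 160\<close>.\<close>

definition oct_dB :: "octonion \<Rightarrow> octonion \<Rightarrow> octonion" where
  "oct_dB y h = (16 * (y \<bullet> h) / (y \<bullet> y) ^ 5) *\<^sub>R oct_e 0 + (16 * h $ 0 / (y \<bullet> y) ^ 5) *\<^sub>R oct_cnj y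
     - (160 * y $ 0 * (y \<bullet> h) / (y \<bullet> y) ^ 6) *\<^sub>R oct_cnj y + (16 * y $ 0 / (y \<bullet> y) ^ 5) *\<^sub>R oct_cnj h"

lemma has_derivative_oct_B:
  assumes "x + oct_cnj a \<noteq> 0"
  shows "((\<lambda>x. oct_B x a) has_derivative oct_dB (x + oct_cnj a)) (at x)"
proof -
  define b where "b y = (- 2) *\<^sub>R (1 / (y \<bullet> y) ^ 4) *\<^sub>R oct_e 0 + 16 *\<^sub>R (1 / (y \<bullet> y) ^ 5) *\<^sub>R (y $ 0) *\<^sub>R oct_cnj y" for y :: octonion
  let ?y = "x + oct_cnj a"
  have 1: "((\<lambda>y::octonion. 1 / (y \<bullet> y) ^ 4) has_derivative (\<lambda>h. - (8 * (?y \<bullet> h) / (?y \<bullet> ?y) ^ 5))) (at ?y)"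
    using has_derivative_inverse_inner_power[OF assms, of 3] by simp
  have 2: "((\<lambda>y::octonion. 1 / (y \<bullet> y) ^ 5) has_derivative (\<lambda>h. - (10 * (?y \<bullet> h) / (?y \<bullet> ?y) ^ 6))) (at ?y)"
    using has_derivative_inverse_inner_power[OF assms, of 4] by simp
  have 3: "((\<lambda>y::octonion. y $ 0) has_derivative (\<lambda>h. h $ 0)) (at ?y)"
    by (rule bounded_linear.has_derivative[OF bounded_linear_vec_nth has_derivative_ident])
  have 4: "(oct_cnj has_derivative oct_cnj) (at ?y)"
    using bounded_linear.has_derivative[OF bounded_linear_oct_cnj has_derivative_ident] by simp
  have dB: "(\<lambda>h. (- 2) *\<^sub>R (- (8 * (y \<bullet> h) / (y \<bullet> y) ^ 5)) *\<^sub>R oct_e 0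
      + 16 *\<^sub>R ((1 / (y \<bullet> y) ^ 5) *\<^sub>R (y $ 0 *\<^sub>R oct_cnj h + h $ 0 *\<^sub>R oct_cnj y)
        + (- (10 * (y \<bullet> h) / (y \<bullet> y) ^ 6)) *\<^sub>R y $ 0 *\<^sub>R oct_cnj y)) = oct_dB y" for y
    unfolding oct_dB_def by (auto simp: fun_eq_iff vec_eq_iff algebra_simps)
  have "(b has_derivative (\<lambda>h. (- 2) *\<^sub>R (- (8 * (?y \<bullet> h) / (?y \<bullet> ?y) ^ 5)) *\<^sub>R oct_e 0
      + 16 *\<^sub>R ((1 / (?y \<bullet> ?y) ^ 5) *\<^sub>R (?y $ 0 *\<^sub>R oct_cnj h + h $ 0 *\<^sub>R oct_cnj ?y)
        + (- (10 * (?y \<bullet> h) / (?y \<bullet> ?y) ^ 6)) *\<^sub>R ?y $ 0 *\<^sub>R oct_cnj ?y))) (at ?y)"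
    unfolding b_def
    by (intro has_derivative_add has_derivative_scaleR_right has_derivative_scaleR_left has_derivative_scaleR 1 2 3 4)
  note this[unfolded dB]
  moreover have "((\<lambda>x. x + oct_cnj a) has_derivative (\<lambda>h. h)) (at x)"
    by (auto intro!: derivative_eq_intros)
  ultimately have "((\<lambda>x. b (x + oct_cnj a)) has_derivative oct_dB ?y) (at x)"
    using has_derivative_compose by blast
  moreover have "open {x. x + oct_cnj a \<noteq> 0}"
    by (intro open_Collect_neq continuous_intros)
  ultimately show ?thesis
    by (rule has_derivative_transform_within_open) (use assms in \<open>auto simp: b_def oct_B_eq\<close>)
qed

text \<open>Every sum is a real multiple of \<open>y_0 / |y|^10\<close>: the first two terms of
  \<open>oct_dB\<close> combine to \<open>16 (y + oct_cnj y)\<close> and give \<open>32\<close>, the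
  third gives \<open>- 160\<close>, and the eight products \<open>e_i (cnj e_i) = 1\<close> give
  \<open>8 * 16 = 128\<close>.\<close>

lemma oct_Dirac_oct_B:
  assumes "x + oct_cnj a \<noteq> 0"
  shows "oct_Dirac (\<lambda>x. oct_B x a) x = 0"
proof -
  define y where "y = x + oct_cnj a"
  have y: "y \<bullet> y \<noteq> 0" using assms by (simp add: y_def)
  have 1: "(\<Sum>i\<in>UNIV. oct_e i \<odot> (c * (y $ i)) *\<^sub>R z) = c *\<^sub>R (y \<odot> z)" for c z
  proof -
    have "y \<odot> z = (\<Sum>i\<in>UNIV. y $ i *\<^sub>R oct_e i) \<odot> z" by (simp only: oct_expansion)
    then show ?thesis
      by (simp add: oct_mult.sum_left oct_mult.scaleR_left oct_mult.scaleR_right scaleR_sum_right)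
  qed
  have 2: "(\<Sum>i\<in>UNIV. oct_e i \<odot> (c * (oct_e i $ 0)) *\<^sub>R z) = c *\<^sub>R z" for c z
    by (simp add: oct_e_nth sum_8 neq_8 oct_mult.scaleR_right)
  have 3: "(\<Sum>i\<in>UNIV. oct_e i \<odot> c *\<^sub>R oct_cnj (oct_e i)) = (8 * c) *\<^sub>R oct_e 0" for c
    by (simp add: oct_mult.scaleR_right oct_mult_cnj vec_eq_iff)
  have "oct_Dirac (\<lambda>x. oct_B x a) x = (\<Sum>i\<in>UNIV. oct_e i \<odot> oct_dB y (oct_e i))"
    unfolding y_def by (rule oct_Dirac_eq[OF has_derivative_oct_B[OF assms]])
  also have "\<dots> = (\<Sum>i\<in>UNIV. oct_e i \<odot> ((16 / (y \<bullet> y) ^ 5) * (y $ i)) *\<^sub>R oct_e 0)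
      + (\<Sum>i\<in>UNIV. oct_e i \<odot> ((16 / (y \<bullet> y) ^ 5) * (oct_e i $ 0)) *\<^sub>R oct_cnj y)
      - (\<Sum>i\<in>UNIV. oct_e i \<odot> ((160 * y $ 0 / (y \<bullet> y) ^ 6) * (y $ i)) *\<^sub>R oct_cnj y)
      + (\<Sum>i\<in>UNIV. oct_e i \<odot> (16 * y $ 0 / (y \<bullet> y) ^ 5) *\<^sub>R oct_cnj (oct_e i))"
    by (simp add: oct_dB_def oct_mult.add_right oct_mult.diff_right sum.distrib sum_subtractf)
  also have "\<dots> = (16 / (y \<bullet> y) ^ 5) *\<^sub>R (y + oct_cnj y)
      - (160 * y $ 0 / (y \<bullet> y) ^ 6) *\<^sub>R (y \<bullet> y) *\<^sub>R oct_e 0 + (8 * (16 * y $ 0 / (y \<bullet> y) ^ 5)) *\<^sub>R oct_e 0"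
    unfolding 1 2 3 by (simp add: oct_mult_cnj power2_norm_eq_inner scaleR_add_right)
  also have "\<dots> = ((16 / (y \<bullet> y) ^ 5) * (2 * y $ 0) - (160 * y $ 0 / (y \<bullet> y) ^ 6) * (y \<bullet> y) + 8 * (16 * y $ 0 / (y \<bullet> y) ^ 5)) *\<^sub>R oct_e 0"
    unfolding oct_add_cnj by (simp only: scaleR_left_distrib scaleR_left_diff_distrib scaleR_scaleR)
  also have "(16 / (y \<bullet> y) ^ 5) * (2 * y $ 0) - (160 * y $ 0 / (y \<bullet> y) ^ 6) * (y \<bullet> y) + 8 * (16 * y $ 0 / (y \<bullet> y) ^ 5) = 0"
    using y by (simp add: power_eq_if divide_simps)
  finally show ?thesis by simp
qed

lemma halfspace_plus_cnj_nonzero: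
  assumes "x \<in> oct_halfspace" "a \<in> oct_halfspace"
  shows "x + oct_cnj a \<noteq> 0"
proof
  assume "x + oct_cnj a = 0"
  then have "(x + oct_cnj a) $ 0 = 0" by simp
  then show False using assms by (simp add: oct_halfspace_def oct_Re_def oct_cnj_nth)
qed

lemma open_oct_halfspace: "open oct_halfspace"
  unfolding oct_halfspace_def oct_Re_def by (intro open_Collect_less continuous_intros)

lemma measurable_oct_halfspace [measurable]: "oct_halfspace \<in> sets borel"
  using open_oct_halfspace by simp

lemma C1_on_oct_B:
  assumes a: "a \<in> oct_halfspace"
  shows "C1_on oct_halfspace (\<lambda>x. oct_B x a)"
proof -
  have bl: "bounded_linear (oct_dB y)" for y
    unfolding oct_dB_def[abs_def]
    by (intro bounded_linear_add bounded_linear_sub bounded_linear_const_scaleR bounded_linear_scaleR_const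
        bounded_linear_oct_cnj bounded_linear_divide bounded_linear_const_mult bounded_linear_vec_nth bounded_linear_inner_right bounded_linear_ident
        bounded_linear_compose[of "\<lambda>x. x / c" for c :: real, OF bounded_linear_divide])
  define f' where "f' x = Blinfun (oct_dB (x + oct_cnj a))" for x
  have f': "blinfun_apply (f' x) = oct_dB (x + oct_cnj a)" for x
    unfolding f'_def by (rule bounded_linear_Blinfun_apply[OF bl])
  have "continuous_on oct_halfspace f'"
  proof (rule continuous_on_blinfun_componentwise)
    fix i :: octonion
    show "continuous_on oct_halfspace (\<lambda>x. blinfun_apply (f' x) i)"
      unfolding f' oct_dB_def
      by (intro continuous_intros bounded_linear.continuous_on[OF bounded_linear_oct_cnj])
         (use halfspace_plus_cnj_nonzero[OF _ a] in auto)
  qed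
  then show ?thesis
    unfolding C1_on_def using f' has_derivative_oct_B halfspace_plus_cnj_nonzero[OF _ a] by metis
qed

section \<open>A Cauchy-type kernel vanishing on the boundary\<close>

text \<open>Bernoulli's inequality at \<open>q - 1\<close>. It makes differences of powers linear:
  with \<open>n = 8\<close> for the Lipschitz constant of the truncation, with \<open>n = 4\<close>
  for the decay at the boundary.\<close>

lemma one_minus_power_le:
  fixes q :: real
  assumes "0 \<le> q"
  shows "1 - q ^ n \<le> real n * (1 - q)"
  using Bernoulli_inequality[of "q - 1" n] assms by (simp add: algebra_simps)

text \<open>
  Truncating the conjugate Cauchy kernel at radius \<open>d\<close> replaces the point mass by a multiple of the
  indicator of a ball, at the price of non-differentiability on a sphere.
\<close>

definition oct_trunc :: "real \<Rightarrow> octonion \<Rightarrow> octonion" where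
  "oct_trunc d y = (1 / max (norm y) d ^ 8) *\<^sub>R y"

lemma norm_oct_trunc_le:
  assumes "0 < d"
  shows "norm (oct_trunc d y) \<le> 1 / d ^ 7"
proof -
  let ?m = "max (norm y) d"
  have m: "0 < ?m" using assms by simp
  have "norm (oct_trunc d y) \<le> ?m / ?m ^ 8"
    using m by (simp add: oct_trunc_def divide_right_mono)
  also have "\<dots> = 1 / ?m ^ 7" using m by (simp add: power_eq_if)
  also have "\<dots> \<le> 1 / d ^ 7" using assms by (intro divide_left_mono power_mono) auto
  finally show ?thesis .
qed

text \<open>The \<open>9\<close> is \<open>1 + 8\<close>: moving the vector under a fixed weight
  costs \<open>1 / d ^ 8\<close>, changing the weight costs \<open>8 / d ^ 8\<close>. By symmetry
  \<open>y\<close> may have the larger norm, so that the change of weight multiplies the shorter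
  vector \<open>z\<close>, whose norm absorbs one power of \<open>?k\<close>.\<close>

lemma lipschitz_oct_trunc:
  assumes d: "0 < d"
  shows "(9 / d ^ 8)-lipschitz_on UNIV (oct_trunc d)"
proof (rule lipschitz_onI)
  have *: "norm (oct_trunc d y - oct_trunc d z) \<le> 9 / d ^ 8 * norm (y - z)" if le: "norm z \<le> norm y" for y z
  proof -
    let ?m = "max (norm y) d" and ?k = "max (norm z) d"
    have k: "d \<le> ?k" "norm z \<le> ?k" "?k \<le> ?m" "0 < ?k" "0 < ?m" using d le by auto
    have mk: "?m - ?k \<le> norm (y - z)"
      using norm_triangle_ineq2[of y z] norm_ge_zero[of "y - z"] le by (auto simp: max_def)
    have q: "0 \<le> ?k / ?m" "?k / ?m \<le> 1" using k by auto
    have eq: "oct_trunc d y - oct_trunc d z = (1 / ?m ^ 8) *\<^sub>R (y - z) + (1 / ?m ^ 8 - 1 / ?k ^ 8) *\<^sub>R z"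
      by (simp add: oct_trunc_def algebra_simps)
    have "1 / ?m ^ 8 \<le> 1 / ?k ^ 8" using k by (intro divide_left_mono power_mono) auto
    then have "norm ((1 / ?m ^ 8 - 1 / ?k ^ 8) *\<^sub>R z) = (1 / ?k ^ 8 - 1 / ?m ^ 8) * norm z"
      by simp
    also have "\<dots> \<le> (1 / ?k ^ 8 - 1 / ?m ^ 8) * ?k"
      using \<open>1 / ?m ^ 8 \<le> 1 / ?k ^ 8\<close> k by (intro mult_left_mono) auto
    also have "\<dots> = (1 - (?k / ?m) ^ 8) / ?k ^ 7"
      using k by (simp add: power_divide field_simps power_eq_if)
    also have "\<dots> \<le> (8 * (1 - ?k / ?m)) / ?k ^ 7"
      using one_minus_power_le[OF q(1), of 8] k by (intro divide_right_mono) auto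
    also have "\<dots> = 8 * (?m - ?k) * (1 / (?m * ?k ^ 7))"
      using k by (simp add: field_simps)
    also have "\<dots> \<le> 8 * (?m - ?k) * (1 / d ^ 8)"
    proof (intro mult_left_mono divide_left_mono)
      have "d * d ^ 7 \<le> ?m * ?k ^ 7" using k d by (intro mult_mono power_mono) auto
      then show "d ^ 8 \<le> ?m * ?k ^ 7" by (simp add: power_eq_if)
    qed (use k d in auto)
    also have "\<dots> \<le> 8 * norm (y - z) * (1 / d ^ 8)"
      using d mk by (intro mult_right_mono mult_left_mono) auto
    finally have 1: "norm ((1 / ?m ^ 8 - 1 / ?k ^ 8) *\<^sub>R z) \<le> 8 * norm (y - z) * (1 / d ^ 8)" .
    have "norm ((1 / ?m ^ 8) *\<^sub>R (y - z)) = 1 / ?m ^ 8 * norm (y - z)" using k by simp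
    also have "\<dots> \<le> 1 / d ^ 8 * norm (y - z)"
      using d by (intro mult_right_mono divide_left_mono power_mono) auto
    finally have "norm ((1 / ?m ^ 8) *\<^sub>R (y - z)) \<le> 1 / d ^ 8 * norm (y - z)" .
    with 1 have "norm (oct_trunc d y - oct_trunc d z) \<le> 1 / d ^ 8 * norm (y - z) + 8 * norm (y - z) * (1 / d ^ 8)"
      unfolding eq by (intro order_trans[OF norm_triangle_ineq] add_mono)
    also have "\<dots> = 9 / d ^ 8 * norm (y - z)" by simp
    finally show ?thesis .
  qed
  show "dist (oct_trunc d y) (oct_trunc d z) \<le> 9 / d ^ 8 * dist y z" for y z
    using *[of y z] *[of z y] by (cases "norm z \<le> norm y") (auto simp: dist_norm norm_minus_commute)
qed (use d in simp)

text \<open>On the sphere \<open>norm y = d\<close>, where the truncation has a corner, the value is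
  a mere convention.\<close>

definition oct_dtrunc :: "real \<Rightarrow> octonion \<Rightarrow> octonion \<Rightarrow> octonion" where
  "oct_dtrunc d y h = (if norm y < d then (1 / d ^ 8) *\<^sub>R h else oct_dE y h)"

lemma has_derivative_oct_trunc:
  assumes d: "0 < d" and y: "norm y \<noteq> d"
  shows "(oct_trunc d has_derivative oct_dtrunc d y) (at y)"
proof (cases "norm y < d")
  case True
  have "((\<lambda>y. (1 / d ^ 8) *\<^sub>R y) has_derivative oct_dtrunc d y) (at y)"
    using True by (auto intro!: derivative_eq_intros simp: oct_dtrunc_def[abs_def])
  moreover have "open {y::octonion. norm y < d}" by (intro open_Collect_less continuous_intros)
  ultimately show ?thesis
    by (rule has_derivative_transform_within_open) (use True in \<open>auto simp: oct_trunc_def max_def\<close>)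
next
  case False
  then have "y \<noteq> 0" using d by auto
  have "((\<lambda>y. (1 / norm y ^ 8) *\<^sub>R y) has_derivative oct_dtrunc d y) (at y)"
    using False has_derivative_oct_cnj_E[of y] \<open>y \<noteq> 0\<close> by (simp add: oct_dtrunc_def[abs_def])
  moreover have "open {y::octonion. d < norm y}" by (intro open_Collect_less continuous_intros)
  ultimately show ?thesis
    by (rule has_derivative_transform_within_open) (use False y in \<open>auto simp: oct_trunc_def max_def\<close>)
qed

text \<open>
  The two summands cancel on the boundary of the half-space, and the truncation does not affect the
  second one inside it.
\<close>

definition oct_theta :: "real \<Rightarrow> octonion \<Rightarrow> octonion \<Rightarrow> octonion" where
  "oct_theta d a x = oct_cnj (oct_trunc d (x - a)) + oct_trunc d (x + oct_cnj a)"

definition oct_dtheta :: "real \<Rightarrow> octonion \<Rightarrow> octonion \<Rightarrow> octonion \<Rightarrow> octonion" where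
  "oct_dtheta d a x h = oct_cnj (oct_dtrunc d (x - a) h) + oct_dtrunc d (x + oct_cnj a) h"

lemma has_derivative_oct_theta:
  assumes "0 < d" "norm (x - a) \<noteq> d" "norm (x + oct_cnj a) \<noteq> d"
  shows "(oct_theta d a has_derivative oct_dtheta d a x) (at x)"
proof -
  have 1: "((\<lambda>x. x - a) has_derivative (\<lambda>h. h)) (at x)" "((\<lambda>x. x + oct_cnj a) has_derivative (\<lambda>h. h)) (at x)"
    by (auto intro!: derivative_eq_intros)
  show ?thesis
    unfolding oct_theta_def[abs_def] oct_dtheta_def[abs_def]
    by (intro has_derivative_add bounded_linear.has_derivative[OF bounded_linear_oct_cnj]
        has_derivative_compose[OF 1(1) has_derivative_oct_trunc]
        has_derivative_compose[OF 1(2) has_derivative_oct_trunc] assms)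
qed

lemma lipschitz_oct_theta:
  assumes "0 < d"
  shows "(18 / d ^ 8)-lipschitz_on UNIV (oct_theta d a)"
proof -
  have cnj: "1-lipschitz_on UNIV oct_cnj"
    by (rule lipschitz_onI) (simp_all add: dist_norm oct_cnj_diff[symmetric])
  have 1: "(9 / d ^ 8)-lipschitz_on UNIV (\<lambda>x. oct_trunc d (x + c))" for c
    using lipschitz_oct_trunc[OF assms] by (auto simp: lipschitz_on_def dist_norm)
      (metis add_diff_cancel_right)
  have "(1 * (9 / d ^ 8))-lipschitz_on UNIV (\<lambda>x. oct_cnj (oct_trunc d (x + (- a))))"
    by (rule lipschitz_on_compose2[OF 1]) (rule lipschitz_on_subset[OF cnj], simp)
  from lipschitz_on_add[OF this 1[of "oct_cnj a"]] show ?thesis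
    by (simp add: oct_theta_def[abs_def])
qed

lemma norm_oct_theta_le:
  assumes "0 < d"
  shows "norm (oct_theta d a x) \<le> 2 / d ^ 7"
proof -
  have "norm (oct_theta d a x) \<le> 1 / d ^ 7 + 1 / d ^ 7"
    unfolding oct_theta_def
    using norm_oct_trunc_le[OF assms] by (intro order_trans[OF norm_triangle_ineq] add_mono) auto
  then show ?thesis by simp
qed

lemma norm_plus_cnj_ge:
  assumes "x \<in> oct_halfspace" "a \<in> oct_halfspace"
  shows "a $ 0 \<le> norm (x + oct_cnj a)" "x $ 0 \<le> norm (x + oct_cnj a)"
proof -
  have "(x + oct_cnj a) $ 0 = x $ 0 + a $ 0" by (simp add: oct_cnj_nth)
  moreover have "(x + oct_cnj a) $ 0 \<le> norm (x + oct_cnj a)"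
    using component_le_norm_cart[of "x + oct_cnj a" 0] by simp
  ultimately show "a $ 0 \<le> norm (x + oct_cnj a)" "x $ 0 \<le> norm (x + oct_cnj a)"
    using assms by (auto simp: oct_halfspace_def oct_Re_def)
qed

text \<open>The two arguments differ by the real number \<open>2 a_0\<close>, itself a multiple of
  \<open>d\<close>. All later bounds can thus be stated through \<open>norm (x + oct_cnj a)\<close>,
  which is at least \<open>a $ 0\<close> on the half-space.\<close>

lemma norm_plus_cnj_le:
  assumes "x \<in> oct_halfspace" "a \<in> oct_halfspace" "0 < d"
  shows "norm (x + oct_cnj a) \<le> (1 + 2 * a $ 0 / d) * max (norm (x - a)) d"
proof -
  have a0: "0 < a $ 0" using assms by (simp add: oct_halfspace_def oct_Re_def)
  have "x + oct_cnj a = (x - a) + (a + oct_cnj a)" by simp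
  then have "norm (x + oct_cnj a) \<le> norm (x - a) + norm (a + oct_cnj a)" by (metis norm_triangle_ineq)
  also have "norm (a + oct_cnj a) = 2 * a $ 0" using a0 by (simp add: oct_add_cnj)
  also have "\<dots> = 2 * a $ 0 / d * d" using assms by simp
  also have "norm (x - a) + 2 * a $ 0 / d * d \<le> max (norm (x - a)) d + 2 * a $ 0 / d * max (norm (x - a)) d"
    using a0 assms by (intro add_mono mult_left_mono) auto
  finally show ?thesis by (simp add: algebra_simps)
qed

lemma inverse_max_power_le:
  assumes "x \<in> oct_halfspace" "a \<in> oct_halfspace" "0 < d"
  shows "1 / max (norm (x - a)) d ^ 8 \<le> (1 + 2 * a $ 0 / d) ^ 8 / norm (x + oct_cnj a) ^ 8"
proof -
  have "norm (x + oct_cnj a) ^ 8 \<le> ((1 + 2 * a $ 0 / d) * max (norm (x - a)) d) ^ 8"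
    by (intro power_mono norm_plus_cnj_le assms norm_ge_zero)
  moreover have "0 < norm (x + oct_cnj a)" using halfspace_plus_cnj_nonzero assms by simp
  moreover have "0 < max (norm (x - a)) d" using assms by simp
  ultimately show ?thesis
    unfolding power_mult_distrib by (simp add: divide_simps mult.commute)
qed

text \<open>Boundary decay has two sources. With equal weights the two summands would add up to the
  real number \<open>2 x_0\<close> times the weight; and the weights differ little because
  \<open>|x + cnj a|^2 - |x - a|^2 = 4 a_0 x_0\<close>. These contribute \<open>2\<close> and
  \<open>16\<close> to the constant \<open>18\<close>. The hypothesis \<open>d < a $ 0\<close> keeps
  the mirror summand untruncated.\<close>

lemma norm_oct_theta_le_halfspace:
  assumes x: "x \<in> oct_halfspace" and a: "a \<in> oct_halfspace" and d: "0 < d" "d < a $ 0"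
  shows "norm (oct_theta d a x) \<le> 18 * (1 + 2 * a $ 0 / d) ^ 8 * x $ 0 / norm (x + oct_cnj a) ^ 8"
proof -
  let ?p = "norm (x + oct_cnj a)" and ?m = "max (norm (x - a)) d"
  have pos: "0 < x $ 0" "0 < a $ 0" using x a by (auto simp: oct_halfspace_def oct_Re_def)
  have p: "a $ 0 \<le> ?p" using norm_plus_cnj_ge[OF x a] by simp
  then have p0: "0 < ?p" using pos by linarith
  have m: "0 < ?m" using d by simp
  have "x + oct_cnj a = (x - a) + (2 * a $ 0) *\<^sub>R oct_e 0"
    by (simp flip: oct_add_cnj)
  then have "?p\<^sup>2 = ((x - a) + (2 * a $ 0) *\<^sub>R oct_e 0) \<bullet> ((x - a) + (2 * a $ 0) *\<^sub>R oct_e 0)"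
    by (simp only: power2_norm_eq_inner)
  also have "\<dots> = (x - a) \<bullet> (x - a) + 2 * (2 * a $ 0 * (x $ 0 - a $ 0)) + (2 * a $ 0) * (2 * a $ 0)"
    by (simp only: inner_add_left inner_add_right inner_scaleR_left inner_scaleR_right inner_oct_e
        vector_minus_component vector_scaleR_component oct_e_nth if_True) (simp add: algebra_simps)
  also have "\<dots> = (norm (x - a))\<^sup>2 + 4 * a $ 0 * x $ 0"
    unfolding power2_norm_eq_inner by (simp only: right_diff_distrib)
  finally have diff: "?p\<^sup>2 = (norm (x - a))\<^sup>2 + 4 * a $ 0 * x $ 0" .
  have "norm (x - a) \<le> ?p"
    by (rule power2_le_imp_le) (use pos in \<open>simp_all add: diff\<close>)
  then have mp: "?m \<le> ?p" using d p by simp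
  have "(norm (x - a))\<^sup>2 \<le> ?m\<^sup>2" by (intro power_mono) auto
  \<comment> \<open>Eighth powers are treated as fourth powers of squares, since it is the
    difference of the squared norms that is known exactly.\<close>
  have "?m ^ 8 = (?m\<^sup>2) ^ 4" "?p ^ 8 = (?p\<^sup>2) ^ 4" by (simp_all add: power_mult[symmetric])
  then have "1 / ?m ^ 8 - 1 / ?p ^ 8 = (1 - (?m\<^sup>2 / ?p\<^sup>2) ^ 4) / ?m ^ 8"
    using m p0 by (simp add: power_divide diff_divide_distrib)
  also have "\<dots> \<le> (4 * (1 - ?m\<^sup>2 / ?p\<^sup>2)) / ?m ^ 8"
    using one_minus_power_le[of "?m\<^sup>2 / ?p\<^sup>2" 4] by (intro divide_right_mono) auto
  also have "1 - ?m\<^sup>2 / ?p\<^sup>2 = (?p\<^sup>2 - ?m\<^sup>2) / ?p\<^sup>2"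
    using p0 by (simp add: diff_divide_distrib)
  also have "4 * ((?p\<^sup>2 - ?m\<^sup>2) / ?p\<^sup>2) / ?m ^ 8 \<le> 4 * ((4 * a $ 0 * x $ 0) / ?p\<^sup>2) / ?m ^ 8"
    using diff \<open>(norm (x - a))\<^sup>2 \<le> ?m\<^sup>2\<close> pos by (intro divide_right_mono mult_left_mono) auto
  finally have "(1 / ?m ^ 8 - 1 / ?p ^ 8) * ?p \<le> 4 * ((4 * a $ 0 * x $ 0) / ?p\<^sup>2) / ?m ^ 8 * ?p"
    by (rule mult_right_mono) simp
  \<comment> \<open>One factor \<open>?p\<close> cancels and \<open>a $ 0 / ?p \<le> 1\<close>
    removes the other, so no constant depending on \<open>a\<close> appears here.\<close>
  also have "\<dots> = 16 * x $ 0 * (a $ 0 / ?p) / ?m ^ 8"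
    using p0 by (simp add: power2_eq_square)
  also have "\<dots> \<le> 16 * x $ 0 * 1 / ?m ^ 8"
    using p p0 pos by (intro divide_right_mono mult_left_mono) auto
  finally have 1: "(1 / ?m ^ 8 - 1 / ?p ^ 8) * ?p \<le> 16 * x $ 0 / ?m ^ 8" by simp
  have "oct_theta d a x = (1 / ?m ^ 8) *\<^sub>R (oct_cnj (x - a) + (x + oct_cnj a)) - (1 / ?m ^ 8 - 1 / ?p ^ 8) *\<^sub>R (x + oct_cnj a)"
    using p d by (simp add: oct_theta_def oct_trunc_def max_def oct_cnj_scaleR
      scaleR_add_right scaleR_left_diff_distrib)
  also have "oct_cnj (x - a) + (x + oct_cnj a) = (2 * x $ 0) *\<^sub>R oct_e 0"
    using oct_add_cnj[of x] by (simp add: oct_cnj_diff add.commute)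
  finally have "norm (oct_theta d a x) \<le> norm ((1 / ?m ^ 8) *\<^sub>R (2 * x $ 0) *\<^sub>R oct_e 0) + norm ((1 / ?m ^ 8 - 1 / ?p ^ 8) *\<^sub>R (x + oct_cnj a))"
    by (simp only: norm_triangle_ineq4)
  also have "norm ((1 / ?m ^ 8) *\<^sub>R (2 * x $ 0) *\<^sub>R oct_e 0) = 2 * x $ 0 / ?m ^ 8" using pos m by simp
  also have "1 / ?p ^ 8 \<le> 1 / ?m ^ 8" using mp m p0 by (intro divide_left_mono power_mono) auto
  then have "norm ((1 / ?m ^ 8 - 1 / ?p ^ 8) *\<^sub>R (x + oct_cnj a)) = (1 / ?m ^ 8 - 1 / ?p ^ 8) * ?p" by simp
  also note 1
  also have "2 * x $ 0 / ?m ^ 8 + 16 * x $ 0 / ?m ^ 8 = 18 * x $ 0 * (1 / ?m ^ 8)" by simp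
  also have "\<dots> \<le> 18 * x $ 0 * ((1 + 2 * a $ 0 / d) ^ 8 / ?p ^ 8)"
    using inverse_max_power_le[OF x a d(1)] pos by (intro mult_left_mono) auto
  finally show ?thesis by (simp add: mult_ac)
qed

text \<open>Inside the ball the first summand is \<open>cnj (x - a) / d ^ 8\<close>, with source
  \<open>8 / d ^ 8\<close>. Outside, its conjugation part and its rank-one part cancel by
  \<open>oct_cnj_mult_mult\<close>. The mirror summand is untruncated on the half-space and supplies
  the kernel.\<close>

lemma oct_source_dtheta:
  assumes x: "x \<in> oct_halfspace" and a: "a \<in> oct_halfspace" and d: "0 < d" "d < a $ 0" 
  shows "oct_source (oct_dtheta d a x) w = (indicator (ball a d) x * 8 / d ^ 8) *\<^sub>R w - oct_cnj (oct_B x a) \<odot> w"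
proof -
  have nz: "x + oct_cnj a \<noteq> 0" by (rule halfspace_plus_cnj_nonzero[OF x a])
  have "oct_source (oct_dtrunc d (x + oct_cnj a)) w = - (oct_cnj (oct_B x a) \<odot> w)"
    using norm_plus_cnj_ge[OF x a] d by (simp add: oct_dtrunc_def[abs_def] oct_source_dE_eq_B[OF nz])
  moreover have "oct_source (\<lambda>h. oct_cnj (oct_dtrunc d (x - a) h)) w = (indicator (ball a d) x * 8 / d ^ 8) *\<^sub>R w"
  proof (cases "norm (x - a) < d")
    case True
    then show ?thesis
      by (simp add: oct_dtrunc_def oct_cnj_scaleR oct_source_scaleR
         oct_source_cnj dist_norm norm_minus_commute)
  next
    case False
    define y where "y = x - a"
    have y: "y \<bullet> y \<noteq> 0" using False d by (auto simp: y_def)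
    have in_y: "oct_source (\<lambda>h. (c * (y \<bullet> h)) *\<^sub>R z) w = c *\<^sub>R (z \<odot> (y \<odot> w))" for c z
      using oct_source_scaleR[of c "\<lambda>h. (y \<bullet> h) *\<^sub>R z" w] by (simp add: oct_source_inner)
    have "oct_source (\<lambda>h. oct_cnj (oct_dE y h)) w = (8 / (y \<bullet> y) ^ 4) *\<^sub>R w - (8 / (y \<bullet> y) ^ 5) *\<^sub>R (y \<bullet> y) *\<^sub>R w"
      by (simp add: oct_dE_def oct_cnj_scaleR
        oct_cnj_diff oct_source_diff oct_source_scaleR oct_source_cnj
        in_y[of "8 / (y \<bullet> y) ^ 5", simplified] oct_cnj_mult_mult power2_norm_eq_inner)
    also have "\<dots> = 0" using y by (simp add: power_eq_if)
    finally show ?thesis using False by (simp add: oct_dtrunc_def y_def dist_norm norm_minus_commute)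
  qed
  ultimately show ?thesis
    unfolding oct_dtheta_def[abs_def] oct_source_add by simp
qed

section \<open>Cut-off functions\<close>

text \<open>Squaring removes the kink of the positive part: at \<open>0\<close> the difference
  quotient is at most \<open>\<bar>h\<bar>\<close>. This is why the factors of the cut-off are
  squared.\<close>

lemma has_real_derivative_max_0_power2:
  "((\<lambda>t::real. (max 0 t)\<^sup>2) has_real_derivative 2 * max 0 t) (at t)"
proof -
  consider "t < 0" | "t = 0" | "0 < t" by linarith
  then show ?thesis
  proof cases
    case 1
    have "((\<lambda>t::real. 0) has_real_derivative 2 * max 0 t) (at t)" using 1 by simp
    then show ?thesis
      by (rule has_field_derivative_transform_within_open[of _ _ _ "{..<0}"]) (use 1 in auto)
  next
    case 3
    have "((\<lambda>t::real. t\<^sup>2) has_real_derivative 2 * max 0 t) (at t)"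
      using 3 by (auto intro!: derivative_eq_intros)
    then show ?thesis
      by (rule has_field_derivative_transform_within_open[of _ _ _ "{0<..}"]) (use 3 in auto)
  next
    case 2
    have "((\<lambda>h::real. (max 0 h)\<^sup>2 / h) \<longlongrightarrow> 0) (at 0)"
    proof (rule Lim_null_comparison)
      show "\<forall>\<^sub>F h in at 0. norm ((max 0 h)\<^sup>2 / h) \<le> \<bar>h\<bar>" 
        by (auto simp: max_def power2_eq_square intro!: always_eventually)
      show "((\<lambda>h::real. \<bar>h\<bar>) \<longlongrightarrow> 0) (at 0)" by (auto intro!: tendsto_eq_intros)
    qed
    then show ?thesis using 2 by (simp add: DERIV_def)
  qed
qed

text \<open>The first factor depends on \<open>x $ 0\<close> only through
  \<open>\<epsilon> / x $ 0\<close>, the scaling that bounds its gradient by a multiple of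
  \<open>1 / x $ 0\<close> uniformly in \<open>\<epsilon>\<close>. The formula is meant for the
  half-space only: where \<open>x $ 0 < 0\<close> and \<open>0 < \<epsilon>\<close> the first factor
  exceeds \<open>1\<close>, so functions multiplied by the cut-off are extended by \<open>0\<close>
  explicitly.\<close>

definition cutoff :: "real \<Rightarrow> octonion \<Rightarrow> real" where
  "cutoff \<epsilon> x = (max 0 (1 - \<epsilon> / x $ 0))\<^sup>2 * (max 0 (1 - \<epsilon>\<^sup>2 * (x \<bullet> x)))\<^sup>2"

definition grad_cutoff :: "real \<Rightarrow> octonion \<Rightarrow> octonion" where
  "grad_cutoff \<epsilon> x =
     (2 * max 0 (1 - \<epsilon> / x $ 0) * (\<epsilon> / (x $ 0)\<^sup>2) * (max 0 (1 - \<epsilon>\<^sup>2 * (x \<bullet> x)))\<^sup>2) *\<^sub>R oct_e 0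
   - (4 * (max 0 (1 - \<epsilon> / x $ 0))\<^sup>2 * max 0 (1 - \<epsilon>\<^sup>2 * (x \<bullet> x)) * \<epsilon>\<^sup>2) *\<^sub>R x"

lemma has_derivative_cutoff:
  assumes "x \<in> oct_halfspace"
  shows "(cutoff \<epsilon> has_derivative (\<lambda>h. grad_cutoff \<epsilon> x \<bullet> h)) (at x)"
proof -
  have x: "x $ 0 \<noteq> 0" using assms by (auto simp: oct_halfspace_def oct_Re_def)
  note D = has_real_derivative_max_0_power2[unfolded has_field_derivative_def]
  have 0: "((\<lambda>y::octonion. y $ 0) has_derivative (\<lambda>h. h $ 0)) (at x)"
    by (rule bounded_linear.has_derivative[OF bounded_linear_vec_nth has_derivative_ident])
  have "((\<lambda>x::octonion. 1 - \<epsilon> / x $ 0) has_derivative (\<lambda>h. \<epsilon> / (x $ 0)\<^sup>2 * h $ 0)) (at x)"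
    using x by (auto intro!: derivative_eq_intros 0 simp: power2_eq_square field_simps)
  note 1 = has_derivative_compose[OF this D]
  have "((\<lambda>x::octonion. 1 - \<epsilon>\<^sup>2 * (x \<bullet> x)) has_derivative (\<lambda>h. - (2 * \<epsilon>\<^sup>2 * (x \<bullet> h)))) (at x)"
    by (auto intro!: derivative_eq_intros simp: inner_commute)
  note 2 = has_derivative_compose[OF this D]
  show ?thesis
    using has_derivative_mult[OF 1 2]
    by (simp add: cutoff_def[abs_def] grad_cutoff_def inner_diff_left algebra_simps)
qed

lemma cutoff_bounds: "0 \<le> cutoff \<epsilon> x" "0 \<le> \<epsilon> \<Longrightarrow> x \<in> oct_halfspace \<Longrightarrow> cutoff \<epsilon> x \<le> 1"
proof -
  show "0 \<le> cutoff \<epsilon> x" by (simp add: cutoff_def)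
  assume "0 \<le> \<epsilon>" "x \<in> oct_halfspace"
  then have "max 0 (1 - \<epsilon> / x $ 0) \<le> 1" "max 0 (1 - \<epsilon>\<^sup>2 * (x \<bullet> x)) \<le> 1"
    by (auto simp: oct_halfspace_def oct_Re_def)
  then show "cutoff \<epsilon> x \<le> 1"
    unfolding cutoff_def by (intro mult_le_one power_le_one) auto
qed

text \<open>Where the first factor is nonzero, \<open>\<epsilon> < x $ 0\<close>, so
  \<open>\<epsilon> / (x $ 0)^2\<close> is below \<open>1 / x $ 0\<close>; where the second is
  nonzero, \<open>\<epsilon> * norm x < 1\<close>, so \<open>\<epsilon>^2 * norm x\<close> is below
  \<open>1 / norm x\<close>. The outer factors \<open>2\<close> and \<open>4\<close> add up to
  \<open>6\<close>.\<close>

lemma norm_grad_cutoff_le: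
  assumes x: "x \<in> oct_halfspace" and e: "0 \<le> \<epsilon>"
  shows "norm (grad_cutoff \<epsilon> x) \<le> 6 / x $ 0"
proof -
  let ?m = "max 0 (1 - \<epsilon> / x $ 0)" and ?k = "max 0 (1 - \<epsilon>\<^sup>2 * (x \<bullet> x))"
  have x0: "0 < x $ 0" using x by (simp add: oct_halfspace_def oct_Re_def)
  have m: "0 \<le> ?m" "?m \<le> 1" using x0 e by auto
  have k: "0 \<le> ?k" "?k \<le> 1" by auto
  have m': "?m * (\<epsilon> / x $ 0) \<le> 1"
  proof (cases "\<epsilon> / x $ 0 \<le> 1")
    case True
    then show ?thesis using m x0 e by (intro mult_le_one) auto
  qed simp
  have k': "?k * (\<epsilon> * norm x)\<^sup>2 \<le> 1"
  proof (cases "(\<epsilon> * norm x)\<^sup>2 \<le> 1")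
    case True
    then show ?thesis using k by (intro mult_le_one) auto
  next
    case False
    then have "?k = 0" by (simp add: power_mult_distrib power2_norm_eq_inner)
    then show ?thesis by simp
  qed
  have xn: "x $ 0 \<le> norm x" using component_le_norm_cart[of x 0] by simp
  then have nx: "0 < norm x" using x0 by linarith
  have "norm ((2 * ?m * (\<epsilon> / (x $ 0)\<^sup>2) * ?k\<^sup>2) *\<^sub>R oct_e 0) = 2 / x $ 0 * (?m * (\<epsilon> / x $ 0)) * ?k\<^sup>2"
    using x0 e m k by (simp add: power2_eq_square)
  also have "\<dots> \<le> 2 / x $ 0 * 1 * 1"
    using x0 e m m' k by (intro mult_mono power_le_one) auto
  finally have 1: "norm ((2 * ?m * (\<epsilon> / (x $ 0)\<^sup>2) * ?k\<^sup>2) *\<^sub>R oct_e 0) \<le> 2 / x $ 0" by simp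
  have "norm ((4 * ?m\<^sup>2 * ?k * \<epsilon>\<^sup>2) *\<^sub>R x) = 4 / norm x * ?m\<^sup>2 * (?k * (\<epsilon> * norm x)\<^sup>2)"
    using x0 xn k by (simp add: power2_eq_square abs_mult)
  also have "\<dots> \<le> 4 / x $ 0 * 1 * 1"
    using x0 xn nx m k k' by (intro mult_mono power_le_one divide_left_mono) auto
  finally have 2: "norm ((4 * ?m\<^sup>2 * ?k * \<epsilon>\<^sup>2) *\<^sub>R x) \<le> 4 / x $ 0" by simp
  have "norm (grad_cutoff \<epsilon> x) \<le> 2 / x $ 0 + 4 / x $ 0"
    unfolding grad_cutoff_def by (rule order_trans[OF norm_triangle_ineq4 add_mono[OF 1 2]])
  then show ?thesis by simp
qed

lemma cutoff_tendsto:
  assumes x: "x \<in> oct_halfspace" and e: "\<epsilon> \<longlonglongrightarrow> 0"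
  shows "(\<lambda>n. cutoff (\<epsilon> n) x) \<longlonglongrightarrow> 1" "(\<lambda>n. grad_cutoff (\<epsilon> n) x) \<longlonglongrightarrow> 0"
proof -
  have x0: "x $ 0 \<noteq> 0" using x by (auto simp: oct_halfspace_def oct_Re_def)
  have "(\<lambda>n. cutoff (\<epsilon> n) x) \<longlonglongrightarrow> (max 0 (1 - 0 / x $ 0))\<^sup>2 * (max 0 (1 - 0\<^sup>2 * (x \<bullet> x)))\<^sup>2"
    unfolding cutoff_def using x0 by (intro tendsto_intros e)
  then show "(\<lambda>n. cutoff (\<epsilon> n) x) \<longlonglongrightarrow> 1" by simp
  have "(\<lambda>n. grad_cutoff (\<epsilon> n) x) \<longlonglongrightarrow>
     (2 * max 0 (1 - 0 / x $ 0) * (0 / (x $ 0)\<^sup>2) * (max 0 (1 - 0\<^sup>2 * (x \<bullet> x)))\<^sup>2) *\<^sub>R oct_e 0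
   - (4 * (max 0 (1 - 0 / x $ 0))\<^sup>2 * max 0 (1 - 0\<^sup>2 * (x \<bullet> x)) * 0\<^sup>2) *\<^sub>R x"
    unfolding grad_cutoff_def using x0 by (intro tendsto_intros e) auto
  then show "(\<lambda>n. grad_cutoff (\<epsilon> n) x) \<longlonglongrightarrow> 0" by simp
qed

lemma cutoff_eq_0:
  assumes x: "x \<in> oct_halfspace" and "0 < \<epsilon>" "x $ 0 \<le> \<epsilon> \<or> 1 \<le> \<epsilon> * norm x"
  shows "cutoff \<epsilon> x = 0" "grad_cutoff \<epsilon> x = 0"
proof -
  have x0: "0 < x $ 0" using x by (simp add: oct_halfspace_def oct_Re_def)
  have "max 0 (1 - \<epsilon> / x $ 0) = 0 \<or> max 0 (1 - \<epsilon>\<^sup>2 * (x \<bullet> x)) = 0"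
    using assms(3)
  proof
    assume "1 \<le> \<epsilon> * norm x"
    then have "1 \<le> (\<epsilon> * norm x)\<^sup>2" by (rule one_le_power)
    then show ?thesis by (simp add: power_mult_distrib power2_norm_eq_inner)
  qed (use x0 in simp)
  then show "cutoff \<epsilon> x = 0" "grad_cutoff \<epsilon> x = 0"
    by (auto simp: cutoff_def grad_cutoff_def)
qed

text \<open>Every point off the half-space has the neighbourhood \<open>x $ 0 < \<epsilon>\<close>,
  on which the extension is identically \<open>0\<close>; boundary values of \<open>f\<close> never
  enter.\<close>

lemma cutoff_mult_has_derivative:
  fixes f :: "octonion \<Rightarrow> octonion"
  assumes f': "\<And>x. x \<in> oct_halfspace \<Longrightarrow> (f has_derivative f' x) (at x)" and e: "0 < \<epsilon>"
  defines "u \<equiv> (\<lambda>x. if x \<in> oct_halfspace then cutoff \<epsilon> x *\<^sub>R f x else 0)"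
  defines "u' \<equiv> (\<lambda>x h. if x \<in> oct_halfspace then cutoff \<epsilon> x *\<^sub>R f' x h + (grad_cutoff \<epsilon> x \<bullet> h) *\<^sub>R f x else 0)"
  shows "(u has_derivative u' x) (at x)"
proof (cases "x \<in> oct_halfspace")
  case True
  have "((\<lambda>x. cutoff \<epsilon> x *\<^sub>R f x) has_derivative u' x) (at x)"
    using has_derivative_scaleR[OF has_derivative_cutoff[OF True] f'[OF True]] True by (simp add: u'_def)
  then show ?thesis
    by (rule has_derivative_transform_within_open[OF _ open_oct_halfspace True]) (simp add: u_def)
next
  case False
  have "((\<lambda>x. 0) has_derivative u' x) (at x)" using False by (simp add: u'_def)
  moreover have "open {x::octonion. x $ 0 < \<epsilon>}" by (intro open_Collect_less continuous_intros)
  moreover have "x \<in> {x. x $ 0 < \<epsilon>}" using False e by (simp add: oct_halfspace_def oct_Re_def)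
  ultimately show ?thesis
    by (rule has_derivative_transform_within_open) (auto simp: u_def cutoff_eq_0[OF _ e])
qed

text \<open>Outside the compact set \<open>S\<close>, which lies inside the half-space, the product
  and its derivative vanish; on \<open>S\<close> continuity bounds \<open>f\<close> and its
  derivative.\<close>

lemma cutoff_mult_lipschitz:
  fixes f :: "octonion \<Rightarrow> octonion"
  assumes f: "C1_on oct_halfspace f" and e: "0 < \<epsilon>"
  defines "u \<equiv> (\<lambda>x. if x \<in> oct_halfspace then cutoff \<epsilon> x *\<^sub>R f x else 0)"
  obtains L K where "L-lipschitz_on UNIV u" "\<And>x. norm (u x) \<le> K"
proof -
  obtain f' :: "octonion \<Rightarrow> octonion \<Rightarrow>\<^sub>L octonion" where
    f': "\<And>x. x \<in> oct_halfspace \<Longrightarrow> (f has_derivative blinfun_apply (f' x)) (at x)" and cont': "continuous_on oct_halfspace f'"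
    using f by (auto simp: C1_on_def)
  have cont: "continuous_on oct_halfspace f"
    using f' by (intro has_derivative_continuous_on) (blast intro: has_derivative_at_withinI)
  define S where "S = cball (0::octonion) (1 / \<epsilon>) \<inter> {x. \<epsilon> \<le> x $ 0}"
  have "closed {x::octonion. \<epsilon> \<le> x $ 0}" by (intro closed_Collect_le continuous_intros)
  then have S: "compact S" unfolding S_def by (intro compact_Int_closed compact_cball)
  have SH: "S \<subseteq> oct_halfspace" using e by (auto simp: S_def oct_halfspace_def oct_Re_def)
  have notS: "x $ 0 \<le> \<epsilon> \<or> 1 \<le> \<epsilon> * norm x" if "x \<notin> S" for x
    using that e by (auto simp: S_def field_simps)
  obtain K where K: "\<And>x. x \<in> S \<Longrightarrow> norm (f x) \<le> K" "0 \<le> K"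
    using compact_imp_bounded[OF compact_continuous_image[OF continuous_on_subset[OF cont SH] S]]
    unfolding bounded_pos by force
  obtain K' where K': "\<And>x. x \<in> S \<Longrightarrow> norm (f' x) \<le> K'" "0 \<le> K'"
    using compact_imp_bounded[OF compact_continuous_image[OF continuous_on_subset[OF cont' SH] S]]
    unfolding bounded_pos by force
  define u' where "u' x h = (if x \<in> oct_halfspace then cutoff \<epsilon> x *\<^sub>R f' x h + (grad_cutoff \<epsilon> x \<bullet> h) *\<^sub>R f x else 0)" for x h
  have du: "(u has_derivative u' x) (at x)" for x
    unfolding u_def u'_def[abs_def] using f' e by (rule cutoff_mult_has_derivative)
  have bound: "norm (u' x h) \<le> (K' + 6 / \<epsilon> * K) * norm h" for x h
  proof (cases "x \<in> S")
    case True
    then have xH: "x \<in> oct_halfspace" and x0: "\<epsilon> \<le> x $ 0" using SH by (auto simp: S_def)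
    have "norm (f' x h) \<le> K' * norm h"
      using K'(1)[OF True] by (intro order_trans[OF norm_blinfun] mult_right_mono) auto
    then have "cutoff \<epsilon> x * norm (f' x h) \<le> 1 * (K' * norm h)"
      using cutoff_bounds[of \<epsilon> x] e xH by (intro mult_mono) auto
    then have "norm (cutoff \<epsilon> x *\<^sub>R f' x h) \<le> 1 * (K' * norm h)"
      using cutoff_bounds(1)[of \<epsilon> x] by simp
    moreover have "norm ((grad_cutoff \<epsilon> x \<bullet> h) *\<^sub>R f x) \<le> (6 / \<epsilon> * norm h) * K"
    proof -
      have "\<bar>grad_cutoff \<epsilon> x \<bullet> h\<bar> \<le> norm (grad_cutoff \<epsilon> x) * norm h" by (rule Cauchy_Schwarz_ineq2)
      also have "\<dots> \<le> 6 / x $ 0 * norm h"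
        using e by (intro mult_right_mono norm_grad_cutoff_le[OF xH]) auto
      also have "\<dots> \<le> 6 / \<epsilon> * norm h"
        using e x0 by (intro mult_right_mono divide_left_mono) auto
      finally have "\<bar>grad_cutoff \<epsilon> x \<bullet> h\<bar> * norm (f x) \<le> (6 / \<epsilon> * norm h) * K"
        using K(1)[OF True] e by (intro mult_mono) auto
      then show ?thesis by simp
    qed
    ultimately show ?thesis
      using xH norm_triangle_ineq[of "cutoff \<epsilon> x *\<^sub>R f' x h" "(grad_cutoff \<epsilon> x \<bullet> h) *\<^sub>R f x"]
      by (simp add: u'_def algebra_simps)
  next
    case False
    then have "u' x h = 0" using cutoff_eq_0[OF _ e notS[OF False]] by (auto simp: u'_def)
    then show ?thesis using K K' e by simp
  qed
  have "(K' + 6 / \<epsilon> * K)-lipschitz_on UNIV u"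
    using K K' e by (intro lipschitz_on_UNIV_derivative[OF du bound]) auto
  moreover have "norm (u x) \<le> K" for x
  proof (cases "x \<in> S")
    case True
    then have xH: "x \<in> oct_halfspace" using SH by auto
    have "cutoff \<epsilon> x * norm (f x) \<le> 1 * K"
      using cutoff_bounds[of \<epsilon> x] e xH K(1)[OF True] by (intro mult_mono) auto
    then show ?thesis using xH cutoff_bounds(1)[of \<epsilon> x] by (simp add: u_def)
  next
    case False
    then have "u x = 0" using cutoff_eq_0[OF _ e notS[OF False]] by (auto simp: u_def)
    then show ?thesis using K by simp
  qed
  ultimately show ?thesis by (rule that)
qed

section \<open>The integral identity with cut-off\<close>

lemma lipschitz_on_oct_mult:
  assumes f: "L-lipschitz_on UNIV f" "\<And>x. norm (f x) \<le> K"
    and g: "M-lipschitz_on UNIV g" "\<And>x. norm (g x) \<le> N"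
  shows "(K * M + L * N)-lipschitz_on UNIV (\<lambda>x. f x \<odot> g x)"
proof (rule lipschitz_onI)
  have "0 \<le> K" "0 \<le> N" using f(2) g(2) norm_ge_zero order_trans by blast+
  then show "0 \<le> K * M + L * N"
    using lipschitz_on_nonneg[OF f(1)] lipschitz_on_nonneg[OF g(1)] by simp
  fix x y
  have "f x \<odot> g x - f y \<odot> g y = f x \<odot> (g x - g y) + (f x - f y) \<odot> g y"
    by (simp add: oct_mult.diff_left oct_mult.diff_right)
  then have "norm (f x \<odot> g x - f y \<odot> g y) \<le> norm (f x) * norm (g x - g y) + norm (f x - f y) * norm (g y)"
    by (metis norm_oct_mult norm_triangle_ineq)
  also have "\<dots> \<le> K * (M * dist x y) + (L * dist x y) * N"
    using f(2)[of x] g(2)[of y] lipschitz_onD[OF f(1), of x y] lipschitz_onD[OF g(1), of x y] \<open>0 \<le> K\<close>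
      lipschitz_on_nonneg[OF f(1)]
    by (intro add_mono mult_mono) (auto simp: dist_norm)
  finally show "dist (f x \<odot> g x) (f y \<odot> g y) \<le> (K * M + L * N) * dist x y"
    by (simp add: dist_norm algebra_simps)
qed

lemma sphere_null_lborel: "sphere c r \<in> null_sets (lborel :: 'a::euclidean_space measure)"
  using negligible_sphere[of c r] by (auto simp: null_sets_completion_iff negligible_iff_null_sets negligible_convex_frontier)

lemma C1_on_continuous_on: "C1_on \<Omega> f \<Longrightarrow> continuous_on \<Omega> f"
  unfolding C1_on_def
  by (auto intro!: continuous_at_imp_continuous_on dest: has_derivative_continuous)

lemma continuous_on_oct_cnj [continuous_intros]:
  "continuous_on S f \<Longrightarrow> continuous_on S (\<lambda>x. oct_cnj (f x))"
  by (rule bounded_linear.continuous_on[OF bounded_linear_oct_cnj])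

lemma continuous_on_oct_B: "a \<in> oct_halfspace \<Longrightarrow> continuous_on oct_halfspace (\<lambda>x. oct_B x a)"
  by (intro C1_on_continuous_on C1_on_oct_B)

text \<open>\<open>G\<close> is the divergence of
  \<open>oct_theta d a x \<odot> (oct_e i \<odot> u x)\<close>, where \<open>u\<close> is the
  cut-off multiple of \<open>f\<close>. Since \<open>Df = 0\<close>, the Dirac sum of
  \<open>u\<close> retains only the gradient of the cut-off times \<open>f\<close>. Measurability is
  recorded because it passes to the limit later.\<close>

lemma cutoff_integral_identity:
  assumes f: "left_oct_analytic_on oct_halfspace f" and a: "a \<in> oct_halfspace"
    and d: "0 < d" "d < a $ 0" and e: "0 < \<epsilon>"
  defines "G \<equiv> (\<lambda>x. indicator oct_halfspace x *\<^sub>R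
      (cutoff \<epsilon> x *\<^sub>R ((indicator (ball a d) x * 8 / d ^ 8) *\<^sub>R f x - oct_cnj (oct_B x a) \<odot> f x)
        + oct_theta d a x \<odot> (grad_cutoff \<epsilon> x \<odot> f x)))"
  shows "G \<in> borel_measurable borel" "integral\<^sup>L lborel G = 0"
proof -
  have C1: "C1_on oct_halfspace f" and Df: "\<And>x. x \<in> oct_halfspace \<Longrightarrow> oct_Dirac f x = 0"
    using f by (auto simp: left_oct_analytic_on_def)
  then obtain f' :: "octonion \<Rightarrow> octonion \<Rightarrow>\<^sub>L octonion" where
    f': "\<And>x. x \<in> oct_halfspace \<Longrightarrow> (f has_derivative blinfun_apply (f' x)) (at x)"
    by (auto simp: C1_on_def)
  have cf: "continuous_on oct_halfspace f" by (rule C1_on_continuous_on[OF C1])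
  have nz: "\<forall>x\<in>oct_halfspace. x $ 0 \<noteq> 0" by (simp add: oct_halfspace_def oct_Re_def)
  have c_cutoff: "continuous_on oct_halfspace (cutoff \<epsilon>)"
    unfolding cutoff_def[abs_def] using nz by (intro continuous_intros)
  have c_grad: "continuous_on oct_halfspace (grad_cutoff \<epsilon>)"
    unfolding grad_cutoff_def[abs_def] using nz by (intro continuous_intros) auto
  have c_theta: "continuous_on oct_halfspace (oct_theta d a)"
    using lipschitz_on_continuous_on[OF lipschitz_oct_theta[OF d(1)]] continuous_on_subset by blast
  have m1: "(\<lambda>x. indicator oct_halfspace x *\<^sub>R (cutoff \<epsilon> x *\<^sub>R f x)) \<in> borel_measurable borel"
    by (intro borel_measurable_continuous_on_indicator measurable_oct_halfspace continuous_intros c_cutoff cf)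
  have m2: "(\<lambda>x. indicator oct_halfspace x *\<^sub>R (oct_theta d a x \<odot> (grad_cutoff \<epsilon> x \<odot> f x) - cutoff \<epsilon> x *\<^sub>R (oct_cnj (oct_B x a) \<odot> f x)))
      \<in> borel_measurable borel"
    by (intro borel_measurable_continuous_on_indicator measurable_oct_halfspace continuous_intros c_cutoff cf c_theta c_grad
        oct_mult.continuous_on continuous_on_oct_B a)
  have "G = (\<lambda>x. (indicator (ball a d) x * 8 / d ^ 8) *\<^sub>R (indicator oct_halfspace x *\<^sub>R (cutoff \<epsilon> x *\<^sub>R f x))
      + indicator oct_halfspace x *\<^sub>R (oct_theta d a x \<odot> (grad_cutoff \<epsilon> x \<odot> f x) - cutoff \<epsilon> x *\<^sub>R (oct_cnj (oct_B x a) \<odot> f x)))"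
    by (auto simp: G_def fun_eq_iff indicator_def algebra_simps)
  also have "\<dots> \<in> borel_measurable borel"
    by (rule borel_measurable_add[OF borel_measurable_scaleR[OF _ m1] m2])
       (intro borel_measurable_divide borel_measurable_times borel_measurable_indicator, auto)
  finally show G: "G \<in> borel_measurable borel" .

  define u where "u x = (if x \<in> oct_halfspace then cutoff \<epsilon> x *\<^sub>R f x else 0)" for x
  define u' where "u' x h = (if x \<in> oct_halfspace then cutoff \<epsilon> x *\<^sub>R f' x h + (grad_cutoff \<epsilon> x \<bullet> h) *\<^sub>R f x else 0)" for x h
  have du: "(u has_derivative u' x) (at x)" for x
    unfolding u_def[abs_def] u'_def[abs_def] using f' e by (rule cutoff_mult_has_derivative)
  obtain L K where L: "L-lipschitz_on UNIV u" and K: "\<And>x. norm (u x) \<le> K"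
    using cutoff_mult_lipschitz[OF C1 e, folded u_def] by blast
  have Du: "(\<Sum>i\<in>UNIV. oct_e i \<odot> u' x (oct_e i)) = indicator oct_halfspace x *\<^sub>R (grad_cutoff \<epsilon> x \<odot> f x)" for x
  proof (cases "x \<in> oct_halfspace")
    case True
    have "grad_cutoff \<epsilon> x \<odot> f x = (\<Sum>i\<in>UNIV. grad_cutoff \<epsilon> x $ i *\<^sub>R oct_e i) \<odot> f x" by (simp only: oct_expansion)
    also have "\<dots> = (\<Sum>i\<in>UNIV. oct_e i \<odot> ((grad_cutoff \<epsilon> x $ i) *\<^sub>R f x))"
      by (simp add: oct_mult.sum_left oct_mult.scaleR_left oct_mult.scaleR_right)
    finally have 1: "(\<Sum>i\<in>UNIV. oct_e i \<odot> ((grad_cutoff \<epsilon> x $ i) *\<^sub>R f x)) = grad_cutoff \<epsilon> x \<odot> f x" by simp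
    have "(\<Sum>i\<in>UNIV. oct_e i \<odot> (cutoff \<epsilon> x *\<^sub>R f' x (oct_e i))) = cutoff \<epsilon> x *\<^sub>R oct_Dirac f x"
      by (simp add: oct_Dirac_eq[OF f'[OF True]] oct_mult.scaleR_right scaleR_sum_right)
    with True 1 show ?thesis
      by (simp add: u'_def oct_mult.add_right sum.distrib Df)
  qed (simp add: u'_def oct_mult.zero_right)
  define \<phi> where "\<phi> i x = oct_theta d a x \<odot> (oct_e i \<odot> u x)" for i x
  show "integral\<^sup>L lborel G = 0"
  proof (rule integral_divergence_eq_0[where I = UNIV and \<phi> = \<phi> and v = oct_e and R = "1 / \<epsilon>"])
    show "(2 / d ^ 7 * L + 18 / d ^ 8 * K)-lipschitz_on UNIV (\<phi> i)" for i
      unfolding \<phi>_def[abs_def]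
    proof (rule lipschitz_on_oct_mult)
      show "L-lipschitz_on UNIV (\<lambda>x. oct_e i \<odot> u x)"
        using L by (simp add: lipschitz_on_def dist_norm norm_oct_mult flip: oct_mult.diff_right)
    qed (auto simp: norm_oct_mult K intro: norm_oct_theta_le lipschitz_oct_theta d)
    show "\<phi> i x = 0" if "1 / \<epsilon> < norm x" for i x
    proof -
      have "1 \<le> \<epsilon> * norm x" using that e by (simp add: field_simps)
      then have "u x = 0" using cutoff_eq_0(1)[OF _ e] by (auto simp: u_def)
      then show ?thesis by (simp add: \<phi>_def)
    qed
    \<comment> \<open>These are the corners of the two truncations. The second sphere misses the
      half-space, but the divergence is needed almost everywhere on the whole space.\<close>
    have "AE x in lborel. x \<notin> sphere a d" "AE x in lborel. x \<notin> sphere (- oct_cnj a) d"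
      by (intro AE_not_in sphere_null_lborel)+
    then show "AE x in lborel. \<exists>D. (\<forall>i\<in>UNIV. ((\<lambda>t. \<phi> i (x + t *\<^sub>R oct_e i)) has_vector_derivative D i) (at 0)) \<and> (\<Sum>i\<in>UNIV. D i) = G x"
    proof eventually_elim
      fix x assume x: "x \<notin> sphere a d" "x \<notin> sphere (- oct_cnj a) d"
      have dth: "(oct_theta d a has_derivative oct_dtheta d a x) (at x)"
        using x by (intro has_derivative_oct_theta d) (auto simp: dist_norm norm_minus_commute add.commute)
      define D where "D i = oct_theta d a x \<odot> (oct_e i \<odot> u' x (oct_e i)) + oct_dtheta d a x (oct_e i) \<odot> (oct_e i \<odot> u x)" for i
      have "((\<lambda>t. \<phi> i (x + t *\<^sub>R oct_e i)) has_vector_derivative D i) (at 0)" for i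
        unfolding D_def \<phi>_def
        by (intro has_vector_derivative_along_line[where v = "oct_e i"
              and f = "\<lambda>x. oct_theta d a x \<odot> (oct_e i \<odot> u x)"
              and f' = "\<lambda>h. oct_theta d a x \<odot> (oct_e i \<odot> u' x h) + oct_dtheta d a x h \<odot> (oct_e i \<odot> u x)"]
            oct_mult.FDERIV dth bounded_linear.has_derivative[OF oct_mult.bounded_linear_right du])
      \<comment> \<open>Bilinearity alone: \<open>oct_theta d a x\<close> is the outermost left
        factor of its terms, and the other terms already carry the brackets of
        \<open>oct_source\<close>.\<close>
      moreover have "(\<Sum>i\<in>UNIV. D i) = oct_theta d a x \<odot> (\<Sum>i\<in>UNIV. oct_e i \<odot> u' x (oct_e i)) + oct_source (oct_dtheta d a x) (u x)"
        by (simp add: D_def oct_source_def sum.distrib oct_mult.sum_right)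
      moreover have "\<dots> = G x"
      proof (cases "x \<in> oct_halfspace")
        case True
        then show ?thesis
          by (simp add: Du G_def u_def oct_source_dtheta[OF True a d] oct_mult.scaleR_right algebra_simps)
      qed (simp add: Du G_def u_def oct_source_def)
      ultimately show "\<exists>D. (\<forall>i\<in>UNIV. ((\<lambda>t. \<phi> i (x + t *\<^sub>R oct_e i)) has_vector_derivative D i) (at 0)) \<and> (\<Sum>i\<in>UNIV. D i) = G x"
        by auto
    qed
  qed (rule G)
qed

section \<open>The Bergman space\<close>

lemma set_integrable_halfspace_bound:
  fixes f :: "octonion \<Rightarrow> 'b::euclidean_space"
  assumes w: "set_integrable lborel oct_halfspace w" and f: "continuous_on oct_halfspace f"
    and le: "\<And>x. x \<in> oct_halfspace \<Longrightarrow> norm (f x) \<le> (w x :: real)"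
  shows "set_integrable lborel oct_halfspace f"
proof (rule set_integrable_bound[OF w])
  show "set_borel_measurable lborel oct_halfspace f"
    unfolding set_borel_measurable_def
    using borel_measurable_continuous_on_indicator[OF measurable_oct_halfspace f] by simp
  show "AE x in lborel. x \<in> oct_halfspace \<longrightarrow> norm (f x) \<le> norm (w x)"
    using le by (auto intro!: AE_I2 order_trans[OF le])
qed

text \<open>The exponent \<open>16 = 2 * 8\<close> is that of the squared kernel bound and exceeds
  the dimension \<open>8\<close>; the singularity \<open>- oct_cnj a\<close> stays at distance at
  least \<open>a $ 0\<close> from the half-space.\<close>

lemma set_integrable_inverse_power_16:
  assumes a: "a \<in> oct_halfspace"
  shows "set_integrable lborel oct_halfspace (\<lambda>x. 1 / norm (x + oct_cnj a) ^ 16)"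
proof -
  let ?g = "\<lambda>y::octonion. indicator {y. a $ 0 \<le> norm y} y / norm y ^ 16 :: real"
  have "integrable lborel ?g"
    using a by (intro integrable_inverse_norm_power) (auto simp: oct_halfspace_def oct_Re_def)
  then have "integrable (distr lborel borel ((+) (oct_cnj a))) ?g"
    by (simp add: lborel_distr_plus)
  then have int: "integrable lborel (\<lambda>x. ?g (oct_cnj a + x))"
    by (rule integrable_distr[rotated]) simp
  have eq: "indicator oct_halfspace x *\<^sub>R (1 / norm (x + oct_cnj a) ^ 16) = indicator oct_halfspace x *\<^sub>R ?g (oct_cnj a + x)" for x
    using norm_plus_cnj_ge[OF _ a, of x] by (auto simp: indicator_def add.commute)
  show ?thesis
    unfolding set_integrable_def eq
    by (intro integrable_mult_indicator int) simp
qed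

lemma oct_bergman_spaceD:
  assumes "f \<in> oct_bergman_space"
  shows "C1_on oct_halfspace f" "continuous_on oct_halfspace f"
    "left_oct_analytic_on oct_halfspace f" "set_integrable lborel oct_halfspace (\<lambda>x. (norm (f x))\<^sup>2)"
  using assms by (auto simp: oct_bergman_space_def left_oct_analytic_on_def intro: C1_on_continuous_on)

lemma oct_B_in_bergman_space:
  assumes a: "a \<in> oct_halfspace"
  shows "(\<lambda>x. oct_B x a) \<in> oct_bergman_space"
proof -
  have "set_integrable lborel oct_halfspace (\<lambda>x. (norm (oct_B x a))\<^sup>2)"
  proof (rule set_integrable_halfspace_bound)
    show "set_integrable lborel oct_halfspace (\<lambda>x. 18\<^sup>2 * (1 / norm (x + oct_cnj a) ^ 16))"
      by (intro set_integrable_mult_right set_integrable_inverse_power_16 a)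
    show "continuous_on oct_halfspace (\<lambda>x. (norm (oct_B x a))\<^sup>2)"
      by (intro continuous_intros continuous_on_oct_B a)
    fix x assume "x \<in> oct_halfspace"
    then have "norm (oct_B x a) \<le> 18 / norm (x + oct_cnj a) ^ 8"
      by (intro norm_oct_B_le halfspace_plus_cnj_nonzero a)
    then have "(norm (oct_B x a))\<^sup>2 \<le> (18 / norm (x + oct_cnj a) ^ 8)\<^sup>2"
      by (intro power_mono) auto
    then show "norm ((norm (oct_B x a))\<^sup>2) \<le> 18\<^sup>2 * (1 / norm (x + oct_cnj a) ^ 16)"
      by (simp add: power_divide power_mult[symmetric])
  qed
  then show ?thesis
    using a by (auto simp: oct_bergman_space_def left_oct_analytic_on_def C1_on_oct_B oct_Dirac_oct_B halfspace_plus_cnj_nonzero)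
qed

text \<open>A pointwise substitute for the Cauchy-Schwarz inequality: it bounds a product of two
  square integrable functions by an integrable one.\<close>

lemma mult_le_sum_squares:
  fixes u v :: real
  shows "u * v \<le> u\<^sup>2 + v\<^sup>2"
proof -
  have "0 \<le> (u - v)\<^sup>2 + (u\<^sup>2 + v\<^sup>2)" by simp
  then show ?thesis by (simp add: power2_diff)
qed

lemma set_integrable_cnj_mult:
  assumes f: "f \<in> oct_bergman_space" and g: "g \<in> oct_bergman_space"
  shows "set_integrable lborel oct_halfspace (\<lambda>x. oct_cnj (g x) \<odot> f x)"
proof (rule set_integrable_halfspace_bound)
  show "set_integrable lborel oct_halfspace (\<lambda>x. (norm (g x))\<^sup>2 + (norm (f x))\<^sup>2)"
    by (intro set_integral_add oct_bergman_spaceD f g)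
  show "continuous_on oct_halfspace (\<lambda>x. oct_cnj (g x) \<odot> f x)"
    by (intro continuous_intros oct_mult.continuous_on oct_bergman_spaceD f g)
qed (simp add: norm_oct_mult mult_le_sum_squares)

section \<open>The reproducing formula\<close>

lemma ball_subset_halfspace:
  assumes "d \<le> a $ 0"
  shows "ball a d \<subseteq> oct_halfspace"
proof
  fix x assume "x \<in> ball a d"
  then have "\<bar>(a - x) $ 0\<bar> < d"
    using component_le_norm_cart[of "a - x" 0] by (simp add: dist_norm)
  then show "x \<in> oct_halfspace" using assms by (simp add: oct_halfspace_def oct_Re_def)
qed

text \<open>The cut-off is removed by dominated convergence: the gradient term tends to
  \<open>0\<close> pointwise, and the rest splits into the ball term and the kernel term. The
  resulting right-hand side is independent of \<open>d\<close>.\<close>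

lemma integral_ball_eq_integral_oct_B:
  assumes f: "f \<in> oct_bergman_space" and a: "a \<in> oct_halfspace" and d: "0 < d" "d < a $ 0"
  shows "set_integrable lborel (ball a d) f"
    "(8 / d ^ 8) *\<^sub>R (LINT x:ball a d|lborel. f x) = (LINT x:oct_halfspace|lborel. oct_cnj (oct_B x a) \<odot> f x)"
proof -
  note fD = oct_bergman_spaceD[OF f]
  let ?p = "\<lambda>x. norm (x + oct_cnj a)"
  define C where "C = (1 + 2 * a $ 0 / d) ^ 8"
  have C: "0 \<le> C" using a d by (simp add: C_def oct_halfspace_def oct_Re_def)
  define e where "e n = inverse (real (Suc n))" for n
  have e: "0 < e n" "e \<longlonglongrightarrow> 0" for n
    unfolding e_def using LIMSEQ_inverse_real_of_nat by auto
  define G where "G n x = indicator oct_halfspace x *\<^sub>R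
      (cutoff (e n) x *\<^sub>R ((indicator (ball a d) x * 8 / d ^ 8) *\<^sub>R f x - oct_cnj (oct_B x a) \<odot> f x)
        + oct_theta d a x \<odot> (grad_cutoff (e n) x \<odot> f x))" for n x
  define G0 where "G0 x = indicator oct_halfspace x *\<^sub>R
      ((indicator (ball a d) x * 8 / d ^ 8) *\<^sub>R f x - oct_cnj (oct_B x a) \<odot> f x)" for x
  note G = cutoff_integral_identity[OF fD(3) a d e(1), folded G_def]
  \<comment> \<open>All bounds have the shape constant times \<open>|x + cnj a|^-8 |f x|\<close>:
    the ball term gives \<open>8 C\<close>, the kernel \<open>18\<close>, the gradient term
    \<open>18 * 6 = 108\<close> times \<open>C\<close>. The product is then split into
    squares.\<close>
  define w where "w x = (116 * C + 18) * (1 / ?p x ^ 16 + (norm (f x))\<^sup>2)" for x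
  have w: "set_integrable lborel oct_halfspace w"
    unfolding w_def
    by (intro set_integrable_mult_right set_integral_add set_integrable_inverse_power_16 a fD(4))
  have conv: "(\<lambda>n. G n x) \<longlonglongrightarrow> G0 x" for x
  proof (cases "x \<in> oct_halfspace")
    case True
    have "(\<lambda>n. G n x) \<longlonglongrightarrow> indicator oct_halfspace x *\<^sub>R
      (1 *\<^sub>R ((indicator (ball a d) x * 8 / d ^ 8) *\<^sub>R f x - oct_cnj (oct_B x a) \<odot> f x)
        + oct_theta d a x \<odot> (0 \<odot> f x))"
      unfolding G_def by (intro tendsto_intros oct_mult.tendsto cutoff_tendsto[OF True e(2)])
    then show ?thesis by (simp add: G0_def)
  qed (simp add: G_def G0_def)
  have bound: "norm (G n x) \<le> indicator oct_halfspace x *\<^sub>R w x" for n x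
  proof (cases "x \<in> oct_halfspace")
    case True
    have p: "0 < ?p x" using halfspace_plus_cnj_nonzero[OF True a] by simp
    have x0: "0 < x $ 0" using True by (simp add: oct_halfspace_def oct_Re_def)
    define q where "q = 1 / ?p x ^ 8"
    have q: "0 \<le> q" by (simp add: q_def)
    have "\<bar>indicator (ball a d) x * 8 / d ^ 8\<bar> \<le> 8 * C * q"
    proof (cases "x \<in> ball a d")
      case ball: True
      then have "1 / d ^ 8 \<le> C / ?p x ^ 8"
        using inverse_max_power_le[OF True a d(1)] by (simp add: C_def dist_norm norm_minus_commute max_def)
      then show ?thesis using ball d by (simp add: q_def)
    qed (use C q in simp)
    then have "norm ((indicator (ball a d) x * 8 / d ^ 8) *\<^sub>R f x) \<le> 8 * C * q * norm (f x)"
      unfolding norm_scaleR by (rule mult_right_mono) simp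
    moreover have "norm (oct_cnj (oct_B x a) \<odot> f x) \<le> 18 * q * norm (f x)"
      using mult_right_mono[OF norm_oct_B_le[OF halfspace_plus_cnj_nonzero[OF True a]], of "norm (f x)"]
      by (simp add: norm_oct_mult q_def)
    ultimately have 1: "norm ((indicator (ball a d) x * 8 / d ^ 8) *\<^sub>R f x - oct_cnj (oct_B x a) \<odot> f x)
        \<le> 8 * C * q * norm (f x) + 18 * q * norm (f x)"
      by (intro order_trans[OF norm_triangle_ineq4] add_mono)
    have 2: "norm (cutoff (e n) x *\<^sub>R ((indicator (ball a d) x * 8 / d ^ 8) *\<^sub>R f x - oct_cnj (oct_B x a) \<odot> f x))
        \<le> 1 * (8 * C * q * norm (f x) + 18 * q * norm (f x))"
      unfolding norm_scaleR
      using cutoff_bounds[of "e n" x] e(1)[of n] True by (intro mult_mono 1) auto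
    have "norm (oct_theta d a x \<odot> (grad_cutoff (e n) x \<odot> f x))
        = norm (oct_theta d a x) * norm (grad_cutoff (e n) x) * norm (f x)"
      by (simp add: norm_oct_mult)
    \<comment> \<open>The decay of \<open>oct_theta\<close> in \<open>x $ 0\<close> pays exactly for
      the \<open>1 / x $ 0\<close> of the gradient.\<close>
    also have "\<dots> \<le> (18 * C * x $ 0 / ?p x ^ 8) * (6 / x $ 0) * norm (f x)"
      using norm_oct_theta_le_halfspace[OF True a d] norm_grad_cutoff_le[OF True, of "e n"] e(1)[of n] C x0
      by (intro mult_right_mono mult_mono) (auto simp: C_def)
    also have "\<dots> = 108 * C * q * norm (f x)" using x0 by (simp add: q_def)
    finally have "norm (G n x) \<le> 1 * (8 * C * q * norm (f x) + 18 * q * norm (f x)) + 108 * C * q * norm (f x)"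
      using True 2 by (simp only: G_def indicator_simps scaleR_one) (intro order_trans[OF norm_triangle_ineq] add_mono)
    also have "\<dots> = (116 * C + 18) * (q * norm (f x))" by (simp add: algebra_simps)
    also have "\<dots> \<le> (116 * C + 18) * (q\<^sup>2 + (norm (f x))\<^sup>2)"
      using C by (intro mult_left_mono mult_le_sum_squares) auto
    also have "q\<^sup>2 = 1 / ?p x ^ 16" by (simp add: q_def power_divide power_mult[symmetric])
    finally show ?thesis using True by (simp add: w_def)
  qed (simp add: G_def)
  have G0: "G0 \<in> borel_measurable lborel"
    using borel_measurable_LIMSEQ_metric[OF G(1) conv] by simp
  have "integrable lborel G0" "(\<lambda>n. integral\<^sup>L lborel (G n)) \<longlonglongrightarrow> integral\<^sup>L lborel G0"
    using integrable_dominated_convergence[OF G0 _ w[unfolded set_integrable_def], of G]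
      integral_dominated_convergence[OF G0 _ w[unfolded set_integrable_def], of G] G(1) conv bound by auto
  then have int0: "integrable lborel G0" and I0: "integral\<^sup>L lborel G0 = 0"
    by (simp_all add: G(2) LIMSEQ_const_iff)
  note intB = set_integrable_cnj_mult[OF f oct_B_in_bergman_space[OF a]]
  have sub: "ball a d \<subseteq> oct_halfspace" using ball_subset_halfspace d by simp
  have eq: "G0 x + indicator oct_halfspace x *\<^sub>R (oct_cnj (oct_B x a) \<odot> f x) = (8 / d ^ 8) *\<^sub>R (indicator (ball a d) x *\<^sub>R f x)" for x
    using sub by (auto simp: G0_def indicator_def)
  have "integrable lborel (\<lambda>x. (8 / d ^ 8) *\<^sub>R (indicator (ball a d) x *\<^sub>R f x))"
    unfolding eq[symmetric] using int0 intB[unfolded set_integrable_def] by (rule Bochner_Integration.integrable_add)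
  then have "integrable lborel (\<lambda>x. (d ^ 8 / 8) *\<^sub>R (8 / d ^ 8) *\<^sub>R (indicator (ball a d) x *\<^sub>R f x))"
    by (rule integrable_scaleR_right)
  moreover have "(d ^ 8 / 8) *\<^sub>R (8 / d ^ 8) *\<^sub>R v = v" for v :: octonion
    using d by simp
  ultimately show "set_integrable lborel (ball a d) f"
    unfolding set_integrable_def by (simp only:)
  have "(8 / d ^ 8) *\<^sub>R (LINT x:ball a d|lborel. f x) = (\<integral>x. G0 x + indicator oct_halfspace x *\<^sub>R (oct_cnj (oct_B x a) \<odot> f x) \<partial>lborel)"
    unfolding eq set_lebesgue_integral_def by (simp del: scaleR_scaleR)
  also have "\<dots> = (LINT x:oct_halfspace|lborel. oct_cnj (oct_B x a) \<odot> f x)"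
    using int0 intB[unfolded set_integrable_def] I0 by (simp add: set_lebesgue_integral_def)
  finally show "(8 / d ^ 8) *\<^sub>R (LINT x:ball a d|lborel. f x) = (LINT x:oct_halfspace|lborel. oct_cnj (oct_B x a) \<odot> f x)" .
qed

text \<open>This is where the normalisation enters: the unit ball has volume
  \<open>pi ^ 4 / 24\<close>, one eighth of the surface area \<open>omega8\<close>.\<close>

lemma measure_ball_octonion: "0 \<le> d \<Longrightarrow> measure lborel (ball (a::octonion) d) = omega8 / 8 * d ^ 8"
  by (simp add: content_ball omega8_def eval_unit_ball_vol)

text \<open>As the integral against the kernel equals \<open>8 / d ^ 8\<close> times the integral
  over the ball for every small \<open>d\<close>, the radius may shrink. Continuity of
  \<open>f\<close> at \<open>a\<close> then suffices, and \<open>8 / d ^ 8\<close> times the volume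
  of the ball is \<open>omega8\<close>.\<close>

lemma integral_oct_B_eq:
  assumes f: "f \<in> oct_bergman_space" and a: "a \<in> oct_halfspace"
  shows "(LINT x:oct_halfspace|lborel. oct_cnj (oct_B x a) \<odot> f x) = omega8 *\<^sub>R f a" (is "?I = _")
proof -
  have w: "0 < omega8" by (simp add: omega8_def)
  have a0: "0 < a $ 0" using a by (simp add: oct_halfspace_def oct_Re_def)
  have "norm (?I - omega8 *\<^sub>R f a) \<le> omega8 * e" if e: "0 < e" for e
  proof -
    have "isCont f a"
      using oct_bergman_spaceD(2)[OF f] open_oct_halfspace a continuous_on_eq_continuous_at by blast
    then obtain r where r: "0 < r" "\<And>x. dist x a < r \<Longrightarrow> dist (f x) (f a) < e"
      using e by (auto simp: continuous_at_eps_delta)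
    define d where "d = min r (a $ 0) / 2"
    have d: "0 < d" "d < a $ 0" "d \<le> r" using r a0 by (auto simp: d_def min_def)
    have I: "?I = (8 / d ^ 8) *\<^sub>R (LINT x:ball a d|lborel. f x)" and int: "integrable lborel (\<lambda>x. indicator (ball a d) x *\<^sub>R f x)"
      using integral_ball_eq_integral_oct_B[OF f a d(1,2)] by (auto simp: set_integrable_def)
    have int1: "integrable lborel (\<lambda>x. indicator (ball a d) x *\<^sub>R c)" for c :: "'c::euclidean_space"
      by (intro integrable_scaleR_left integrable_real_indicator) (auto simp: emeasure_lborel_ball_finite[unfolded infinity_ennreal_def])
    have "norm (\<integral>x. indicator (ball a d) x *\<^sub>R (f x - f a) \<partial>lborel) \<le> (\<integral>x. indicator (ball a d) x *\<^sub>R e \<partial>lborel)"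
    proof (rule Bochner_Integration.integral_norm_bound_integral)
      show "integrable lborel (\<lambda>x. indicator (ball a d) x *\<^sub>R (f x - f a))"
        unfolding scaleR_diff_right by (intro Bochner_Integration.integrable_diff int int1)
      show "norm (indicator (ball a d) x *\<^sub>R (f x - f a)) \<le> indicator (ball a d) x *\<^sub>R e" for x
        using r(2)[of x] d by (auto simp: indicator_def dist_norm norm_minus_commute)
    qed (rule int1)
    also have "\<dots> = omega8 / 8 * d ^ 8 * e" using d by (simp add: measure_ball_octonion)
    also have "(\<integral>x. indicator (ball a d) x *\<^sub>R (f x - f a) \<partial>lborel) = (LINT x:ball a d|lborel. f x) - (omega8 / 8 * d ^ 8) *\<^sub>R f a"
    proof -
      have "(\<integral>x. indicator (ball a d) x *\<^sub>R f a \<partial>lborel) = (\<integral>x. indicator (ball a d) x \<partial>lborel) *\<^sub>R f a"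
        by (rule integral_scaleR_left) (use int1[of "1::real"] in simp)
      then show ?thesis
        unfolding scaleR_diff_right Bochner_Integration.integral_diff[OF int int1]
        using d by (simp add: set_lebesgue_integral_def measure_ball_octonion)
    qed
    finally have *: "norm ((LINT x:ball a d|lborel. f x) - (omega8 / 8 * d ^ 8) *\<^sub>R f a) \<le> omega8 / 8 * d ^ 8 * e" .
    have "?I - omega8 *\<^sub>R f a = (8 / d ^ 8) *\<^sub>R ((LINT x:ball a d|lborel. f x) - (omega8 / 8 * d ^ 8) *\<^sub>R f a)"
      unfolding I using d by (simp add: scaleR_diff_right)
    then have "norm (?I - omega8 *\<^sub>R f a) = (8 / d ^ 8) * norm ((LINT x:ball a d|lborel. f x) - (omega8 / 8 * d ^ 8) *\<^sub>R f a)"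
      using d by simp
    also have "\<dots> \<le> (8 / d ^ 8) * (omega8 / 8 * d ^ 8 * e)"
      using * d by (intro mult_left_mono) auto
    finally show ?thesis using d by simp
  qed
  from this[of "e / omega8" for e] have "norm (?I - omega8 *\<^sub>R f a) \<le> e" if "0 < e" for e
    using w that by simp
  then have "norm (?I - omega8 *\<^sub>R f a) \<le> 0" by (rule field_le_epsilon[of _ 0, simplified])
  then show ?thesis by simp
qed

lemma oct_B_reproducing:
  assumes "f \<in> oct_bergman_space" "a \<in> oct_halfspace"
  shows "f a = oct_bergman_inner f (\<lambda>x. oct_B x a)"
  unfolding oct_bergman_inner_def integral_oct_B_eq[OF assms] by (simp add: omega8_def)

section \<open>Uniqueness of the kernel\<close>

lemma oct_bergman_space_diff:
  assumes f: "f \<in> oct_bergman_space" and g: "g \<in> oct_bergman_space"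
  shows "(\<lambda>x. f x - g x) \<in> oct_bergman_space"
proof -
  obtain f' :: "octonion \<Rightarrow> octonion \<Rightarrow>\<^sub>L octonion" where
    f': "\<And>x. x \<in> oct_halfspace \<Longrightarrow> (f has_derivative blinfun_apply (f' x)) (at x)" and cf': "continuous_on oct_halfspace f'"
    using oct_bergman_spaceD(1)[OF f] by (auto simp: C1_on_def)
  obtain g' :: "octonion \<Rightarrow> octonion \<Rightarrow>\<^sub>L octonion" where
    g': "\<And>x. x \<in> oct_halfspace \<Longrightarrow> (g has_derivative blinfun_apply (g' x)) (at x)" and cg': "continuous_on oct_halfspace g'"
    using oct_bergman_spaceD(1)[OF g] by (auto simp: C1_on_def)
  have d: "((\<lambda>x. f x - g x) has_derivative blinfun_apply (f' x - g' x)) (at x)" if "x \<in> oct_halfspace" for x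
    using has_derivative_diff[OF f'[OF that] g'[OF that]] by (simp add: minus_blinfun.rep_eq)
  have "C1_on oct_halfspace (\<lambda>x. f x - g x)"
    unfolding C1_on_def using d continuous_on_diff[OF cf' cg'] by (intro exI[of _ "\<lambda>x. f' x - g' x"]) auto
  moreover have "oct_Dirac (\<lambda>x. f x - g x) x = 0" if x: "x \<in> oct_halfspace" for x
  proof -
    have "oct_Dirac (\<lambda>x. f x - g x) x = oct_Dirac f x - oct_Dirac g x"
      unfolding oct_Dirac_eq[OF d[OF x]] oct_Dirac_eq[OF f'[OF x]] oct_Dirac_eq[OF g'[OF x]]
      by (simp add: minus_blinfun.rep_eq oct_mult.diff_right sum_subtractf)
    then show ?thesis
      using oct_bergman_spaceD(3)[OF f] oct_bergman_spaceD(3)[OF g] x by (simp add: left_oct_analytic_on_def)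
  qed
  moreover have "set_integrable lborel oct_halfspace (\<lambda>x. (norm (f x - g x))\<^sup>2)"
  proof (rule set_integrable_halfspace_bound)
    show "set_integrable lborel oct_halfspace (\<lambda>x. 2 * ((norm (f x))\<^sup>2 + (norm (g x))\<^sup>2))"
      by (intro set_integrable_mult_right set_integral_add oct_bergman_spaceD f g)
    show "continuous_on oct_halfspace (\<lambda>x. (norm (f x - g x))\<^sup>2)"
      by (intro continuous_intros oct_bergman_spaceD f g)
    fix x
    have "(norm (f x - g x))\<^sup>2 \<le> (norm (f x) + norm (g x))\<^sup>2"
      by (intro power_mono norm_triangle_ineq4) simp
    also have "\<dots> \<le> 2 * ((norm (f x))\<^sup>2 + (norm (g x))\<^sup>2)"
      using zero_le_power2[of "norm (f x) - norm (g x)"] by (simp add: power2_sum power2_diff)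
    finally show "norm ((norm (f x - g x))\<^sup>2) \<le> 2 * ((norm (f x))\<^sup>2 + (norm (g x))\<^sup>2)" by simp
  qed
  ultimately show ?thesis by (simp add: oct_bergman_space_def left_oct_analytic_on_def)
qed

text \<open>The points of \<open>S\<close> where \<open>h\<close> is nonzero form an open null set,
  hence none exist. This turns equality in the square mean into equality at each point.\<close>

lemma continuous_AE_zero_imp_zero:
  fixes h :: "'a::euclidean_space \<Rightarrow> 'b::real_normed_vector"
  assumes "open S" "continuous_on S h" and ae: "AE x in lborel. x \<in> S \<longrightarrow> h x = 0" and "x \<in> S"
  shows "h x = 0"
proof (rule ccontr)
  assume nz: "h x \<noteq> 0"
  define U where "U = S \<inter> h -` (- {0})"
  have U: "open U" unfolding U_def using assms(1,2) by (intro continuous_open_preimage) auto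
  have "AE x in lborel. x \<notin> U" using ae by eventually_elim (auto simp: U_def)
  then have "U \<in> null_sets lborel"
    using U by (subst AE_iff_null_sets) auto
  then have "negligible U"
    by (simp add: negligible_iff_null_sets null_sets_completionI)
  then show False
    using open_not_negligible[OF U] nz \<open>x \<in> S\<close> by (auto simp: U_def)
qed

text \<open>Because \<open>oct_cnj (h x) \<odot> h x\<close> is the real number
  \<open>|h x|^2\<close>, the octonion-valued inner product is definite.\<close>

lemma oct_bergman_inner_self_eq_0:
  assumes h: "h \<in> oct_bergman_space" and 0: "oct_bergman_inner h h = 0" and x: "x \<in> oct_halfspace"
  shows "h x = 0"
proof -
  have int: "integrable lborel (\<lambda>x. indicator oct_halfspace x *\<^sub>R (norm (h x))\<^sup>2)"
    using oct_bergman_spaceD(4)[OF h] by (simp add: set_integrable_def)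
  have "(LINT x:oct_halfspace|lborel. oct_cnj (h x) \<odot> h x) = (\<integral>x. (indicator oct_halfspace x *\<^sub>R (norm (h x))\<^sup>2) *\<^sub>R oct_e 0 \<partial>lborel)"
    by (simp add: set_lebesgue_integral_def oct_cnj_mult)
  also have "\<dots> = (\<integral>x. indicator oct_halfspace x *\<^sub>R (norm (h x))\<^sup>2 \<partial>lborel) *\<^sub>R oct_e 0"
    using int by (intro integral_scaleR_left) auto
  finally have "(\<integral>x. indicator oct_halfspace x *\<^sub>R (norm (h x))\<^sup>2 \<partial>lborel) *\<^sub>R oct_e 0 = 0"
    using 0 by (simp add: oct_bergman_inner_def omega8_def)
  then have "(\<integral>x. indicator oct_halfspace x *\<^sub>R (norm (h x))\<^sup>2 \<partial>lborel) = 0"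
    by (simp add: axis_eq_0_iff)
  then have "AE x in lborel. indicator oct_halfspace x *\<^sub>R (norm (h x))\<^sup>2 = 0"
    using integral_nonneg_eq_0_iff_AE[OF int] by simp
  then have "AE x in lborel. x \<in> oct_halfspace \<longrightarrow> h x = 0"
    by eventually_elim (auto simp: indicator_def)
  then show ?thesis
    by (rule continuous_AE_zero_imp_zero[OF open_oct_halfspace oct_bergman_spaceD(2)[OF h] _ x])
qed

theorem theorem1p1:
  shows "is_oct_bergman_kernel oct_B \<and>
    (\<forall>a\<in>oct_halfspace. \<forall>g\<in>oct_bergman_space.
       (\<forall>f\<in>oct_bergman_space. f a = oct_bergman_inner f g) \<longrightarrow>
       (\<forall>x\<in>oct_halfspace. g x = oct_B x a))"
proof (intro conjI ballI impI)
  show "is_oct_bergman_kernel oct_B"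
    unfolding is_oct_bergman_kernel_def using oct_B_in_bergman_space oct_B_reproducing by auto
next
  fix a g x
  assume a: "a \<in> oct_halfspace" and g: "g \<in> oct_bergman_space"
    and rep: "\<forall>f\<in>oct_bergman_space. f a = oct_bergman_inner f g" and x: "x \<in> oct_halfspace"
  note B = oct_B_in_bergman_space[OF a]
  define h where "h x = g x - oct_B x a" for x
  have h: "h \<in> oct_bergman_space"
    unfolding h_def by (rule oct_bergman_space_diff[OF g B])
  have "oct_cnj (h x) \<odot> h x = oct_cnj (g x) \<odot> h x - oct_cnj (oct_B x a) \<odot> h x" for x
    by (simp add: h_def oct_cnj_diff oct_mult.diff_left)
  \<comment> \<open>The difference \<open>h\<close> serves as its own test function: both kernels
    reproduce \<open>h a\<close>, so the two inner products on the right cancel.\<close>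
  then have "oct_bergman_inner h h = oct_bergman_inner h g - oct_bergman_inner h (\<lambda>x. oct_B x a)"
    using set_integrable_cnj_mult[OF h g] set_integrable_cnj_mult[OF h B]
    by (simp add: oct_bergman_inner_def scaleR_diff_right)
  also have "\<dots> = 0"
    using rep h oct_B_reproducing[OF h a] by auto
  finally have "h x = 0" by (rule oct_bergman_inner_self_eq_0[OF h _ x])
  then show "g x = oct_B x a" by (simp add: h_def)
qed

end
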